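(* Let $C$ be a cycle on $n\ge 3$ vertices and let $h:V(C)\to\mathbb{N}$ be a hatness function with $h(v)\geq 2$ for every vertex $v$ of $C$. Then the hat guessing game $\langle C,h\rangle$ is winning if and only if at least one of the following conditions holds: 1. The length $n$ is either equal to $4$ or divisible by $3$, and moreover $h(v)\leq 3$ for all $v\in V(C)$. 2. $n=3$ and $\sum_{v\in V(C)}\frac{1}{h(v)}\geq 1$. 3. The game $\langle C,h\rangle$ contains a winning proper subgame. 4. Both of the following hold: (a) there exist three consecutive vertices of $C$ (read along the cycle in one of its two directions) whose hatnesses are, in this order, $(2,3,3)$ or $(3,2,3)$; and (b) $h(v)\leq 4$ for all $v\in V(C)$.
   Context: All graphs are finite, simple and undirected. Given a graph $G$ and a function $h:V(G)\to\mathbb{N}$ to the positive integers (the hatness function; $h(v)$ is the hatness of $v$), the hat guessing game $\langle G,h\rangle$ is as follows. A coloring assigns to each vertex $v$ a color from $[h(v)]=\{1,\dots,h(v)\}$. A strategy assigns to each vertex $v$ a deterministic guessing function $f_v$ whose input is the tuple of colors of the neighbors of $v$ in $G$ and whose output is a guess in $[h(v)]$. The players win on a coloring if at least one vertex $v$ has its guess equal to its own assigned color. The game $\langle G,h\rangle$ is winning if there is a strategy for which the players win on every coloring, and losing otherwise. A subgame of $\langle G,h\rangle$ is a game $\langle G',h'\rangle$ with $G'\subseteq G$ a subgraph and $h'=h|_{V(G')}$; it is proper if $G'$ is a proper subgraph of $G$. *)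

theory Defs
  imports Complex_Main "HOL-Library.FuncSet"
begin

text \<open>Finite simple undirected graphs; an edge is a two-element set of vertices.\<close>

record 'a graph =
  verts :: "'a set"
  edges :: "'a set set"

definition simple_graph :: "'a graph \<Rightarrow> bool" where
  "simple_graph G \<longleftrightarrow>
     finite (verts G) \<and> (\<forall>e\<in>edges G. e \<subseteq> verts G \<and> card e = 2)"

definition subgraph :: "'a graph \<Rightarrow> 'a graph \<Rightarrow> bool" where
  "subgraph H G \<longleftrightarrow>
     simple_graph H \<and> simple_graph G \<and> verts H \<subseteq> verts G \<and> edges H \<subseteq> edges G"

definition neighbors :: "'a graph \<Rightarrow> 'a \<Rightarrow> 'a set" where
  "neighbors G v = {u \<in> verts G. {v, u} \<in> edges G}"

text \<open>
  The vertices in cyclic order. Rotations and the reversal of such an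
  ordering are again such orderings, so both directions of reading are covered.
\<close>

definition cyclic_ordering :: "'a graph \<Rightarrow> nat \<Rightarrow> (nat \<Rightarrow> 'a) \<Rightarrow> bool" where
  "cyclic_ordering C n c \<longleftrightarrow>
     n \<ge> 3 \<and> bij_betw c {..<n} (verts C) \<and>
     edges C = {{c i, c (Suc i mod n)} | i. i < n}"

definition cycle_graph :: "'a graph \<Rightarrow> nat \<Rightarrow> bool" where
  "cycle_graph C n \<longleftrightarrow> (\<exists>c. cyclic_ordering C n c)"

definition consecutive_on_cycle :: "'a graph \<Rightarrow> nat \<Rightarrow> 'a \<Rightarrow> 'a \<Rightarrow> 'a \<Rightarrow> bool" where
  "consecutive_on_cycle C n x y z \<longleftrightarrow>
     (\<exists>c i. cyclic_ordering C n c \<and> i < n \<and>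
        x = c i \<and> y = c ((i + 1) mod n) \<and> z = c ((i + 2) mod n))"

text \<open>
  A tuple of colors indexed by a vertex set is an extensional function on that set,
  so what a vertex sees is the restriction of the coloring to its neighbors.
\<close>

definition colorings_on :: "'a set \<Rightarrow> ('a \<Rightarrow> nat) \<Rightarrow> ('a \<Rightarrow> nat) set" where
  "colorings_on A h = (\<Pi>\<^sub>E v\<in>A. {1..h v})"

definition strategies :: "'a graph \<Rightarrow> ('a \<Rightarrow> nat) \<Rightarrow> ('a \<Rightarrow> ('a \<Rightarrow> nat) \<Rightarrow> nat) set" where
  "strategies G h = (\<Pi> v\<in>verts G. colorings_on (neighbors G v) h \<rightarrow> {1..h v})"

definition wins_on ::
    "'a graph \<Rightarrow> ('a \<Rightarrow> ('a \<Rightarrow> nat) \<Rightarrow> nat) \<Rightarrow> ('a \<Rightarrow> nat) \<Rightarrow> bool" where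
  "wins_on G f c \<longleftrightarrow> (\<exists>v\<in>verts G. f v (restrict c (neighbors G v)) = c v)"

definition winning :: "'a graph \<Rightarrow> ('a \<Rightarrow> nat) \<Rightarrow> bool" where
  "winning G h \<longleftrightarrow> (\<exists>f\<in>strategies G h. \<forall>c\<in>colorings_on (verts G) h. wins_on G f c)"

definition subgame :: "'a graph \<Rightarrow> ('a \<Rightarrow> nat) \<Rightarrow> 'a graph \<Rightarrow> ('a \<Rightarrow> nat) \<Rightarrow> bool" where
  "subgame G' h' G h \<longleftrightarrow> subgraph G' G \<and> h' = restrict h (verts G')"

definition proper_subgame :: "'a graph \<Rightarrow> ('a \<Rightarrow> nat) \<Rightarrow> 'a graph \<Rightarrow> ('a \<Rightarrow> nat) \<Rightarrow> bool" where
  "proper_subgame G' h' G h \<longleftrightarrow> subgame G' h' G h \<and> G' \<noteq> G"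

end

theory Submission
  imports Defs
begin

text \<open>
  Losing: cut the cycle at a vertex 0, fix its color $a$ and the color $b$ of vertex 1, and walk around,
  keeping track of the pairs of consecutive colors reachable while every vertex passed guesses wrong.
  A walk that returns to $a$ is a coloring on which only vertex 0 can be right, and vertex 0 sees just the
  last color and $b$; hence the sets of such pairs for the different $a$ are disjoint. Lower bounds for their sizes depend only on how many colors of vertex 2 make vertex 1 guess $b$,
  and in almost every losing case they do not fit.

  If all hatnesses are 3 and $n \ge 5$, the bounds fit exactly. Equality at every vertex forces three
  families of bijections between the colors of neighboring vertices, each of which can be followed forever
  without a right guess. The three holonomies around the cycle are $P$, $P \rho^n$, $P \rho^{2n}$ for
  a 3-cycle $\rho$, so one of them has a fixed point unless 3 divides $n$; and for 3 dividing $n$ the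
  same structure with fixed-point free $P$ is a winning strategy.

  Winning with hatness 4: such a color is a pair of bits, one for each incident edge, and every edge
  makes a right guess of one bit at one of its ends; a vertex wins if it gets both of its bits right.
\<close>

section \<open>The game along a periodic sequence\<close>

text \<open>The thresholds 2, 3, 5 shape the proof. A walk carries one of two guarantees: hatness at
  least 3 preserves either, hatness 2 lowers the stronger to the weaker, hatness at least 5 raises
  the weaker to the stronger. On the other hand bits pass through hatnesses up to 4, so two 2s with
  only such vertices between them win without the rest of the cycle, which gives a winning proper
  subgame. If there is none, any two 2s have a hatness of at least 5 between them on both sides, and
  the stronger guarantee is back before each further 2. If all hatnesses are at most 4, at most one
  2 remains; outside condition 4 its surroundings dominate 4, 2, 4 or 4, 2, 3, 4 in one direction,
  with 3s elsewhere, and both lose by counting. Without any 2, a single 4 among 3s loses by counting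
  too, which leaves the tight case of all 3s. Monotonicity in the hatnesses reduces each losing case
  to such an extreme pattern. Length 4 escapes the rigidity argument and has a sporadic strategy;
  length 3 is decided by a plain count of colorings.\<close>

lemma periodic_add_mult:
  fixes g :: "int \<Rightarrow> 'b" and N :: int
  assumes "\<And>i. g (i + N) = g i"
  shows "g (i + k * N) = g i"
proof (induction k rule: int_induct[where k = 0])
  case base
  then show ?case by simp
next
  case (step1 k)
  then show ?case using assms[of "i + k * N"] by (simp add: algebra_simps)
next
  case (step2 k)
  then show ?case using assms[of "i + (k - 1) * N"] by (simp add: algebra_simps)
qed

lemma periodic_mod_eq:
  fixes g :: "int \<Rightarrow> 'b" and N :: int
  assumes "\<And>i. g (i + N) = g i" and "i mod N = j mod N"
  shows "g i = g j"
proof -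
  have "g i = g (i mod N)" for i
    using periodic_add_mult[of g N "i mod N" "i div N"] assms(1) by simp
  then show ?thesis using assms(2) by metis
qed

text \<open>
  Colors start at 0 here. A strategy receives the left and the right neighbor's color, and its guesses
  are not confined to the possible colors, so lowering the hatness keeps a strategy.
\<close>

definition cyc_coloring :: "nat \<Rightarrow> (int \<Rightarrow> nat) \<Rightarrow> (int \<Rightarrow> nat) \<Rightarrow> bool" where
  "cyc_coloring n h x \<longleftrightarrow> (\<forall>i. x i < h i) \<and> (\<forall>i. x (i + int n) = x i)"

definition cyc_strategy :: "nat \<Rightarrow> (int \<Rightarrow> nat) \<Rightarrow> (int \<Rightarrow> nat \<Rightarrow> nat \<Rightarrow> nat) \<Rightarrow> bool" where
  "cyc_strategy n h f \<longleftrightarrow> (\<forall>i. f (i + int n) = f i) \<and>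
     (\<forall>x. cyc_coloring n h x \<longrightarrow> (\<exists>i. f i (x (i - 1)) (x (i + 1)) = x i))"

definition cyc_winning :: "nat \<Rightarrow> (int \<Rightarrow> nat) \<Rightarrow> bool" where
  "cyc_winning n h \<longleftrightarrow> (\<exists>f. cyc_strategy n h f)"

lemma cyc_coloring_mod_eq:
  "cyc_coloring n h x \<Longrightarrow> i mod int n = j mod int n \<Longrightarrow> x i = x j"
  by (rule periodic_mod_eq[of x "int n"]) (auto simp: cyc_coloring_def)

lemma cyc_strategy_mod_eq:
  "cyc_strategy n h f \<Longrightarrow> i mod int n = j mod int n \<Longrightarrow> f i = f j"
  by (rule periodic_mod_eq[of f "int n"]) (auto simp: cyc_strategy_def)

lemma cyc_strategyI:
  assumes n: "n > 0"
    and win: "\<And>x. cyc_coloring n h x \<Longrightarrow> \<exists>i\<in>{0..<int n}. g i (x (i - 1)) (x (i + 1)) = x i"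
  shows "cyc_strategy n h (\<lambda>i. g (i mod int n))"
  unfolding cyc_strategy_def
proof (intro conjI allI impI)
  fix x assume "cyc_coloring n h x"
  then obtain i where "i \<in> {0..<int n}" "g i (x (i - 1)) (x (i + 1)) = x i"
    using win by blast
  then show "\<exists>i. g (i mod int n) (x (i - 1)) (x (i + 1)) = x i"
    by (intro exI[of _ i]) simp
qed simp

lemma cyc_strategy_mono:
  assumes "cyc_strategy n h f" and "\<And>i. h' i \<le> h i"
  shows "cyc_strategy n h' f"
proof -
  have "cyc_coloring n h x" if "cyc_coloring n h' x" for x
    using that assms(2) unfolding cyc_coloring_def by (meson less_le_trans)
  then show ?thesis using assms(1) by (auto simp: cyc_strategy_def)
qed

lemma cyc_strategy_shift:
  assumes "cyc_strategy n h f"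
  shows "cyc_strategy n (\<lambda>i. h (i + k)) (\<lambda>i. f (i + k))"
  unfolding cyc_strategy_def
proof (intro conjI allI impI)
  fix i
  show "f (i + int n + k) = f (i + k)"
    by (rule cyc_strategy_mod_eq[OF assms]) (metis add.assoc add.commute mod_add_self2)
next
  fix x assume x: "cyc_coloring n (\<lambda>i. h (i + k)) x"
  have "cyc_coloring n h (\<lambda>i. x (i - k))"
    unfolding cyc_coloring_def
  proof (intro conjI allI)
    fix i
    show "x (i - k) < h i"
      using x unfolding cyc_coloring_def by (metis diff_add_cancel)
    show "x (i + int n - k) = x (i - k)"
      by (rule cyc_coloring_mod_eq[OF x]) (metis add_diff_eq diff_add_eq mod_add_self2)
  qed
  then obtain i where "f i (x (i - 1 - k)) (x (i + 1 - k)) = x (i - k)"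
    using assms unfolding cyc_strategy_def by blast
  then show "\<exists>i. f (i + k) (x (i - 1)) (x (i + 1)) = x i"
    by (intro exI[of _ "i - k"]) (simp add: algebra_simps)
qed

lemma cyc_strategy_reflect:
  assumes "cyc_strategy n h f"
  shows "cyc_strategy n (\<lambda>i. h (- i)) (\<lambda>i a c. f (- i) c a)"
  unfolding cyc_strategy_def
proof (intro conjI allI impI)
  fix i
  have "f (- (i + int n)) = f (- i)"
    by (rule cyc_strategy_mod_eq[OF assms]) simp
  then show "(\<lambda>a c. f (- (i + int n)) c a) = (\<lambda>a c. f (- i) c a)" by simp
next
  fix x assume x: "cyc_coloring n (\<lambda>i. h (- i)) x"
  have "cyc_coloring n h (\<lambda>i. x (- i))"
    unfolding cyc_coloring_def
  proof (intro conjI allI)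
    fix i
    show "x (- i) < h i"
      using x unfolding cyc_coloring_def by (metis minus_minus)
    show "x (- (i + int n)) = x (- i)"
      by (rule cyc_coloring_mod_eq[OF x]) simp
  qed
  then obtain i where "f i (x (- (i - 1))) (x (- (i + 1))) = x (- i)"
    using assms unfolding cyc_strategy_def by blast
  then show "\<exists>i. f (- i) (x (i + 1)) (x (i - 1)) = x i"
    by (intro exI[of _ "- i"]) (simp add: algebra_simps minus_diff_commute)
qed

lemma cyc_winning_mono:
  "cyc_winning n h \<Longrightarrow> (\<And>i. h' i \<le> h i) \<Longrightarrow> cyc_winning n h'"
  unfolding cyc_winning_def using cyc_strategy_mono by blast

lemma cyc_winning_shift: "cyc_winning n h \<Longrightarrow> cyc_winning n (\<lambda>i. h (i + k))"
  unfolding cyc_winning_def using cyc_strategy_shift by blast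

lemma cyc_winning_reflect: "cyc_winning n h \<Longrightarrow> cyc_winning n (\<lambda>i. h (- i))"
  unfolding cyc_winning_def using cyc_strategy_reflect by blast

section \<open>Unrolling a cycle graph onto the integers\<close>

definition cyc_param :: "'a graph \<Rightarrow> nat \<Rightarrow> (int \<Rightarrow> 'a) \<Rightarrow> bool" where
  "cyc_param C n p \<longleftrightarrow> n \<ge> 3 \<and> range p = verts C \<and>
     (\<forall>i j. p i = p j \<longleftrightarrow> i mod int n = j mod int n) \<and>
     edges C = range (\<lambda>i. {p i, p (i + 1)})"

lemma cyclic_ordering_imp_cyc_param:
  assumes "cyclic_ordering C n c"
  shows "cyc_param C n (\<lambda>i. c (nat (i mod int n)))"
proof -
  have n: "n \<ge> 3" and bij: "bij_betw c {..<n} (verts C)"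
    and E: "edges C = {{c i, c (Suc i mod n)} | i. i < n}"
    using assms by (auto simp: cyclic_ordering_def)
  define p where "p = (\<lambda>i. c (nat (i mod int n)))"
  have lt: "nat (i mod int n) < n" for i :: int
    using n by (simp add: nat_less_iff)
  have pint: "p (int k) = c k" if "k < n" for k
    using that by (simp add: p_def)
  have psuc: "p (int k + 1) = c (Suc k mod n)" for k
  proof -
    have "(int k + 1) mod int n = int (Suc k mod n)"
      by (simp add: zmod_int add.commute)
    then show ?thesis by (simp add: p_def)
  qed
  have pinj: "p i = p j \<longleftrightarrow> i mod int n = j mod int n" for i j
  proof
    assume "p i = p j"
    then have "nat (i mod int n) = nat (j mod int n)"
      using bij lt unfolding p_def bij_betw_def inj_on_def by blast
    then show "i mod int n = j mod int n"
      using n by (simp add: eq_nat_nat_iff)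
  qed (simp add: p_def)
  have pmod: "p i = p (int (nat (i mod int n)))" for i
    using n by (simp add: pinj)
  have pmod1: "p (i + 1) = p (int (nat (i mod int n)) + 1)" for i
    using n by (simp add: pinj mod_add_left_eq)
  have "range p = verts C"
  proof
    show "range p \<subseteq> verts C"
      using bij lt by (auto simp: p_def bij_betw_def)
    show "verts C \<subseteq> range p"
    proof
      fix v assume "v \<in> verts C"
      then obtain k where "k < n" "v = c k" using bij by (auto simp: bij_betw_def)
      then show "v \<in> range p" using pint by (metis rangeI)
    qed
  qed
  moreover have "edges C = range (\<lambda>i. {p i, p (i + 1)})"
  proof
    show "edges C \<subseteq> range (\<lambda>i. {p i, p (i + 1)})"
    proof
      fix e assume "e \<in> edges C"
      then obtain k where "k < n" "e = {c k, c (Suc k mod n)}" using E by blast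
      then have "e = {p (int k), p (int k + 1)}" using pint psuc by simp
      then show "e \<in> range (\<lambda>i. {p i, p (i + 1)})" by blast
    qed
    show "range (\<lambda>i. {p i, p (i + 1)}) \<subseteq> edges C"
    proof
      fix e assume "e \<in> range (\<lambda>i. {p i, p (i + 1)})"
      then obtain i where e: "e = {p i, p (i + 1)}" by blast
      define k where "k = nat (i mod int n)"
      have "e = {c k, c (Suc k mod n)}"
        using e pmod[of i] pmod1[of i] pint[of k] psuc[of k] lt[of i] by (simp add: k_def)
      then show "e \<in> edges C" using E lt[of i] k_def by blast
    qed
  qed
  ultimately show ?thesis
    using n pinj unfolding cyc_param_def p_def[symmetric] by blast
qed

lemma cyc_param_imp_cyclic_ordering:
  assumes "cyc_param C n p"
  shows "cyclic_ordering C n (\<lambda>k. p (int k))"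
proof -
  have n: "n \<ge> 3" and r: "range p = verts C"
    and pinj: "\<And>i j. p i = p j \<longleftrightarrow> i mod int n = j mod int n"
    and E: "edges C = range (\<lambda>i. {p i, p (i + 1)})"
    using assms by (auto simp: cyc_param_def)
  have psuc: "p (int (Suc k mod n)) = p (int k + 1)" for k
    by (simp add: pinj zmod_int add.commute)
  have lt: "nat (i mod int n) < n" for i :: int
    using n by (simp add: nat_less_iff)
  have pmod: "p i = p (int (nat (i mod int n)))" for i
    using n by (simp add: pinj)
  have pmod1: "p (i + 1) = p (int (nat (i mod int n)) + 1)" for i
    using n by (simp add: pinj mod_add_left_eq)
  have "inj_on (\<lambda>k. p (int k)) {..<n}"
    by (auto simp: inj_on_def pinj)
  moreover have "(\<lambda>k. p (int k)) ` {..<n} = verts C"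
    proof (intro equalityI subsetI)
    fix v assume "v \<in> verts C"
    then obtain i where "v = p i" using r by auto
    then show "v \<in> (\<lambda>k. p (int k)) ` {..<n}"
      using pmod[of i] lt[of i] by blast
  qed (use r in auto)
  moreover have "edges C = {{p (int i), p (int (Suc i mod n))} | i. i < n}"
    unfolding E psuc
  proof (intro equalityI subsetI)
    fix e assume "e \<in> range (\<lambda>i. {p i, p (i + 1)})"
    then obtain i where "e = {p i, p (i + 1)}" by blast
    then have "e = {p (int (nat (i mod int n))), p (int (nat (i mod int n)) + 1)}"
      using pmod[of i] pmod1[of i] by simp
    then show "e \<in> {{p (int i), p (int i + 1)} | i. i < n}" using lt[of i] by blast
  qed auto
  ultimately show ?thesis using n by (simp add: cyclic_ordering_def bij_betw_def)
qed

text \<open>Indexing by all integers turns rotation and reversal of a cyclic ordering into the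
  substitutions \<open>i + k\<close> and \<open>- i\<close>, with no wrap-around to treat.\<close>

lemma cyc_param_shift:
  assumes "cyc_param C n p"
  shows "cyc_param C n (\<lambda>i. p (i + k))"
proof -
  have "range (\<lambda>i. p (i + k)) = range p"
    using surj_plus[of k] by (metis add.commute full_SetCompr_eq image_image surj_def)
  moreover have "range (\<lambda>i. {p (i + k), p (i + 1 + k)}) = range (\<lambda>i. {p i, p (i + 1)})"
  proof (intro equalityI subsetI)
    fix e assume "e \<in> range (\<lambda>i. {p i, p (i + 1)})"
    then obtain i where "e = {p i, p (i + 1)}" by blast
    then have "e = {p (i - k + k), p (i - k + 1 + k)}" by (simp add: algebra_simps)
    then show "e \<in> range (\<lambda>i. {p (i + k), p (i + 1 + k)})" by blast
  qed (auto simp: algebra_simps)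
  moreover have "(i + k) mod int n = (j + k) mod int n \<longleftrightarrow> i mod int n = j mod int n" for i j
    by (metis add_diff_cancel_right' mod_add_cong mod_diff_cong)
  ultimately show ?thesis using assms unfolding cyc_param_def by simp
qed

lemma cyc_param_reflect:
  assumes "cyc_param C n p"
  shows "cyc_param C n (\<lambda>i. p (- i))"
proof -
  have "range (\<lambda>i. p (- i)) = range p"
    by (metis image_image surj_uminus)
  moreover have "range (\<lambda>i. {p (- i), p (- (i + 1))}) = range (\<lambda>i. {p i, p (i + 1)})"
  proof (intro equalityI subsetI)
    fix e assume "e \<in> range (\<lambda>i. {p i, p (i + 1)})"
    then obtain i where "e = {p i, p (i + 1)}" by blast
    then have "e = {p (- (- i - 1)), p (- (- i - 1 + 1))}" by (simp add: insert_commute add.commute)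
    then show "e \<in> range (\<lambda>i. {p (- i), p (- (i + 1))})" by blast
  next
    fix e assume "e \<in> range (\<lambda>i. {p (- i), p (- (i + 1))})"
    then obtain i where "e = {p (- i), p (- (i + 1))}" by blast
    then have "e = {p (- i - 1), p (- i - 1 + 1)}" by (simp add: insert_commute minus_diff_commute)
    then show "e \<in> range (\<lambda>i. {p i, p (i + 1)})" by blast
  qed
  moreover have "(- i) mod int n = (- j) mod int n \<longleftrightarrow> i mod int n = j mod int n" for i j
    by (metis minus_minus mod_minus_cong)
  ultimately show ?thesis using assms unfolding cyc_param_def by simp
qed

lemma consecutive_on_cycle_cyc_param:
  assumes "cyc_param C n p"
  shows "consecutive_on_cycle C n (p i) (p (i + 1)) (p (i + 2))"
proof -
  have n: "n \<ge> 3" using assms by (simp add: cyc_param_def)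
  have "cyclic_ordering C n (\<lambda>k. p (int k + i))"
    using cyc_param_imp_cyclic_ordering[OF cyc_param_shift[OF assms, of i]] by simp
  then show ?thesis
    unfolding consecutive_on_cycle_def using n
    by (intro exI[of _ "\<lambda>k. p (int k + i)"] exI[of _ 0]) (simp add: algebra_simps)
qed

lemma consecutive_on_cycleE:
  assumes "consecutive_on_cycle C n x y z"
  obtains p where "cyc_param C n p" "x = p 0" "y = p 1" "z = p 2"
proof -
  obtain c i where c: "cyclic_ordering C n c" and i: "i < n"
    and e: "x = c i" "y = c ((i + 1) mod n)" "z = c ((i + 2) mod n)"
    using assms unfolding consecutive_on_cycle_def by blast
  define p where "p = (\<lambda>k. c (nat ((k + int i) mod int n)))"
  have "cyc_param C n p"
    unfolding p_def using cyc_param_shift[OF cyclic_ordering_imp_cyc_param[OF c], of "int i"] .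
  moreover have "p (int j) = c ((i + j) mod n)" for j
  proof -
    have "(int j + int i) mod int n = int ((i + j) mod n)"
      by (simp add: zmod_int add.commute)
    then show ?thesis by (simp add: p_def)
  qed
  from this[of 0] this[of 1] this[of 2] have "x = p 0" "y = p 1" "z = p 2"
    using e i by simp_all
  ultimately show thesis using that by blast
qed

lemma cyc_param_neighbors:
  assumes "cyc_param C n p"
  shows "neighbors C (p i) = {p (i - 1), p (i + 1)}"
proof -
  have n: "n \<ge> 3" and r: "range p = verts C"
    and pinj: "\<And>i j. p i = p j \<longleftrightarrow> i mod int n = j mod int n"
    and E: "edges C = range (\<lambda>i. {p i, p (i + 1)})"
    using assms by (auto simp: cyc_param_def)
  have *: "p (j + 1) = p (i + 1)" if "p i = p j" for j
    using that by (simp add: pinj) (metis mod_add_cong)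
  have **: "p j = p (i - 1)" if "p i = p (j + 1)" for j
    using that by (simp add: pinj) (metis add_diff_cancel_right' mod_diff_cong)
  show ?thesis
  proof (intro equalityI subsetI)
    fix u assume "u \<in> neighbors C (p i)"
    then obtain j where "{p i, u} = {p j, p (j + 1)}"
      unfolding neighbors_def E by auto
    then have "p i = p j \<and> u = p (j + 1) \<or> p i = p (j + 1) \<and> u = p j"
      by (auto simp: doubleton_eq_iff)
    then show "u \<in> {p (i - 1), p (i + 1)}"
      using *[of j] **[of j] by blast
  next
    have "{p i, p (i - 1)} = {p (i - 1), p (i - 1 + 1)}" by auto
    then have "{p i, p (i - 1)} \<in> edges C" unfolding E by blast
    moreover have "{p i, p (i + 1)} \<in> edges C" unfolding E by blast
    moreover fix u assume "u \<in> {p (i - 1), p (i + 1)}"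
    ultimately show "u \<in> neighbors C (p i)"
      using r unfolding neighbors_def by auto
  qed
qed

text \<open>Here \<open>n \<ge> 3\<close> enters: a view is indexed by vertices, so the colors to
  the left and right are two separate entries only if these vertices differ.\<close>

lemma cyc_param_dist2:
  assumes "cyc_param C n p"
  shows "p (i - 1) \<noteq> p (i + 1)"
proof
  assume "p (i - 1) = p (i + 1)"
  then have "(i + 1) mod int n = (i - 1) mod int n" using assms by (simp add: cyc_param_def)
  then have "int n dvd (i + 1) - (i - 1)" by (simp add: mod_eq_dvd_iff)
  then have "int n dvd 2" by simp
  then have "int n \<le> 2" by (rule zdvd_imp_le) simp
  then show False using assms by (simp add: cyc_param_def)
qed

lemma winning_imp_cyc_winning:
  assumes p: "cyc_param C n p" and win: "winning C h"
  shows "cyc_winning n (\<lambda>i. h (p i))"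
proof -
  have r: "range p = verts C"
    and pinj: "\<And>i j. p i = p j \<longleftrightarrow> i mod int n = j mod int n"
    using p by (auto simp: cyc_param_def)
  obtain F where F: "\<And>c. c \<in> colorings_on (verts C) h \<Longrightarrow> wins_on C F c"
    using win by (auto simp: winning_def)
  define view where "view i a b = (\<lambda>u\<in>{p (i - 1), p (i + 1)}. if u = p (i - 1) then Suc a else Suc b)"
    for i a b
  define f where "f i a b = F (p i) (view i a b) - 1" for i a b
  have pp: "p (i + int n) = p i" for i by (simp add: pinj)
  have per: "f (i + int n) = f i" for i
    using pp[of i] pp[of "i - 1"] pp[of "i + 1"]
    unfolding f_def view_def by (simp add: algebra_simps)
  have "\<exists>i. f i (x (i - 1)) (x (i + 1)) = x i" if x: "cyc_coloring n (\<lambda>i. h (p i)) x" for x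
  proof -
    define c where "c = (\<lambda>v\<in>verts C. Suc (x (SOME i. p i = v)))"
    have cp: "c (p i) = Suc (x i)" for i
    proof -
      have "p (SOME j. p j = p i) = p i" by (rule someI[of "\<lambda>j. p j = p i" i]) simp
      then have "x (SOME j. p j = p i) = x i"
        using cyc_coloring_mod_eq[OF x] pinj by blast
      then show ?thesis using r by (auto simp: c_def)
    qed
    have "c \<in> colorings_on (verts C) h"
      unfolding colorings_on_def
    proof (rule PiE_I)
      fix v assume "v \<in> verts C"
      then obtain i where "v = p i" using r by auto
      then show "c v \<in> {1..h v}"
        using cp[of i] x by (auto simp: cyc_coloring_def Suc_le_eq)
    qed (simp add: c_def)
    then obtain v where "v \<in> verts C" "F v (restrict c (neighbors C v)) = c v"
      using F unfolding wins_on_def by blast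
    moreover then obtain i where "v = p i" using r by auto
    moreover have "restrict c (neighbors C (p i)) = view i (x (i - 1)) (x (i + 1))"
      unfolding cyc_param_neighbors[OF p] view_def using cp cyc_param_dist2[OF p, of i] by (auto simp: restrict_def fun_eq_iff)
    ultimately have "F (p i) (view i (x (i - 1)) (x (i + 1))) = Suc (x i)"
      using cp by simp
    then show ?thesis unfolding f_def by (intro exI[of _ i]) simp
  qed
  then show ?thesis
    unfolding cyc_winning_def cyc_strategy_def using per by blast
qed

text \<open>\<open>G\<close> may lack edges of the cycle, provided the ends of a missing edge ignore
  each other. With \<open>G\<close> equal to \<open>C\<close> this transfers a win on the sequence;
  with one edge removed it yields a proper subgame.\<close>

lemma cyc_strategy_imp_winning:
  assumes p: "cyc_param C n p" and f: "cyc_strategy n (\<lambda>i. h (p i)) f"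
    and pos: "\<And>v. v \<in> verts C \<Longrightarrow> h v \<ge> 1"
    and vG: "verts G = verts C"
    and ignore: "\<And>i. {p i, p (i + 1)} \<notin> edges G \<Longrightarrow>
      (\<forall>a b b'. f i a b = f i a b') \<and> (\<forall>a a' b. f (i + 1) a b = f (i + 1) a' b)"
  shows "winning G h"
proof -
  have r: "range p = verts C"
    and pinj: "\<And>i j. p i = p j \<longleftrightarrow> i mod int n = j mod int n"
    using p by (auto simp: cyc_param_def)
  define idx where "idx v = (SOME i. p i = v)" for v
  have idx: "p (idx v) = v" if "v \<in> verts C" for v
    unfolding idx_def using that r by (metis (mono_tags) rangeE someI_ex)
  define g where "g v t = f (idx v) (t (p (idx v - 1)) - 1) (t (p (idx v + 1)) - 1)" for v t
  \<comment> \<open>A guess that is no color of \<open>v\<close> cannot be right, so it may be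
    replaced by 1, a legal guess since \<open>h v \<ge> 1\<close>.\<close>
  define F where "F v t = (if g v t < h v then Suc (g v t) else 1)" for v t
  have "F \<in> strategies G h"
    using pos unfolding strategies_def F_def vG by (auto simp: Suc_le_eq)
  moreover have "wins_on G F c" if c: "c \<in> colorings_on (verts G) h" for c
  proof -
    have c1: "c (p i) \<ge> 1" "c (p i) \<le> h (p i)" for i
      using c r vG unfolding colorings_on_def by (auto simp: PiE_iff)
    define x where "x i = c (p i) - 1" for i
    have x: "cyc_coloring n (\<lambda>i. h (p i)) x"
      unfolding cyc_coloring_def x_def
    proof (intro conjI allI)
      fix i
      show "c (p i) - 1 < h (p i)" using c1[of i] by linarith
      have "p (i + int n) = p i" by (simp add: pinj)
      then show "c (p (i + int n)) - 1 = c (p i) - 1" by simp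
    qed
    then obtain i where i: "f i (x (i - 1)) (x (i + 1)) = x i"
      using f unfolding cyc_strategy_def by blast
    define j where "j = idx (p i)"
    have "p j = p i" unfolding j_def using idx r by blast
    then have ji: "j mod int n = i mod int n" using pinj by blast
    have "f j = f i" by (rule cyc_strategy_mod_eq[OF f ji])
    moreover have "x (j - 1) = x (i - 1)" "x (j + 1) = x (i + 1)" "x j = x i"
      by (rule cyc_coloring_mod_eq[OF x], metis ji mod_diff_cong mod_add_cong)+
    ultimately have fj: "f j (x (j - 1)) (x (j + 1)) = x j" using i by simp
    define t where "t = restrict c (neighbors G (p j))"
    have R: "f j a (t (p (j + 1)) - 1) = f j a (x (j + 1))" for a
    proof (cases "{p j, p (j + 1)} \<in> edges G")
      case True
      then have "p (j + 1) \<in> neighbors G (p j)" using r vG by (auto simp: neighbors_def)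
      then show ?thesis by (simp add: t_def x_def)
    next
      case False
      then show ?thesis using ignore[of j] by metis
    qed
    have L: "f j (t (p (j - 1)) - 1) b = f j (x (j - 1)) b" for b
    proof (cases "{p (j - 1), p j} \<in> edges G")
      case True
      then have "p (j - 1) \<in> neighbors G (p j)" using r vG by (auto simp: neighbors_def insert_commute)
      then show ?thesis by (simp add: t_def x_def)
    next
      case False
      then show ?thesis using ignore[of "j - 1"] by simp
    qed
    have "idx (p j) = j" using \<open>p j = p i\<close> by (simp add: j_def)
    then have "g (p j) t = x j"
      unfolding g_def using fj L R by simp
    then have "F (p j) t = c (p j)"
      unfolding F_def x_def using c1[of j] by auto
    then show ?thesis
      unfolding wins_on_def t_def using r vG by blast
  qed
  ultimately show ?thesis unfolding winning_def by blast
qed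

lemma cyc_winning_imp_winning:
  assumes "cyc_param C n p" "cyc_winning n (\<lambda>i. h (p i))" "\<And>v. v \<in> verts C \<Longrightarrow> h v \<ge> 1"
  shows "winning C h"
proof -
  obtain f where "cyc_strategy n (\<lambda>i. h (p i)) f" using assms(2) by (auto simp: cyc_winning_def)
  moreover have "{p i, p (i + 1)} \<in> edges C" for i using assms(1) by (auto simp: cyc_param_def)
  ultimately show ?thesis using cyc_strategy_imp_winning[OF assms(1)] assms(3) by blast
qed

text \<open>The vertices of \<open>H\<close> replay the given strategy on the part of their view
  lying in \<open>H\<close>; all others guess 1.\<close>

lemma winning_subgraph:
  assumes sub: "subgraph H G" and win: "winning H h'" and eq: "h' = restrict h (verts H)"
    and pos: "\<And>v. v \<in> verts G \<Longrightarrow> h v \<ge> 1"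
  shows "winning G h"
proof -
  have V: "verts H \<subseteq> verts G" and E: "edges H \<subseteq> edges G"
    using sub by (auto simp: subgraph_def)
  then have N: "neighbors H v \<subseteq> neighbors G v" for v by (auto simp: neighbors_def)
  have NV: "neighbors H v \<subseteq> verts H" for v by (auto simp: neighbors_def)
  obtain F where F: "F \<in> strategies H h'"
    and Fw: "\<And>c. c \<in> colorings_on (verts H) h' \<Longrightarrow> wins_on H F c"
    using win by (auto simp: winning_def)
  have restr: "restrict c A \<in> colorings_on A h'"
    if "c \<in> colorings_on B h" "A \<subseteq> B" "A \<subseteq> verts H" for c A B
    using that unfolding colorings_on_def eq by (auto simp: PiE_iff)
  define F' where "F' v t = (if v \<in> verts H then F v (restrict t (neighbors H v)) else 1)" for v t
  have "F' \<in> strategies G h"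
    unfolding strategies_def
  proof (intro Pi_I)
    fix v t assume v: "v \<in> verts G" and t: "t \<in> colorings_on (neighbors G v) h"
    show "F' v t \<in> {1..h v}"
    proof (cases "v \<in> verts H")
      case True
      then have "F v (restrict t (neighbors H v)) \<in> {1..h' v}"
        using F restr[OF t N NV] unfolding strategies_def by (auto dest!: Pi_mem)
      then show ?thesis using True by (simp add: F'_def eq)
    qed (use pos v in \<open>simp add: F'_def\<close>)
  qed
  moreover have "wins_on G F' c" if c: "c \<in> colorings_on (verts G) h" for c
  proof -
    obtain v where v: "v \<in> verts H"
      and w: "F v (restrict (restrict c (verts H)) (neighbors H v)) = restrict c (verts H) v"
      using Fw[OF restr[OF c V order_refl]] unfolding wins_on_def by blast
    have "restrict (restrict c (verts H)) (neighbors H v) = restrict (restrict c (neighbors G v)) (neighbors H v)"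
      using N[of v] NV[of v] by (simp add: Int_absorb1)
    then have "F' v (restrict c (neighbors G v)) = c v"
      using v w by (simp add: F'_def)
    then show ?thesis using v V by (auto simp: wins_on_def)
  qed
  ultimately show ?thesis unfolding winning_def by blast
qed

section \<open>Winning strategies\<close>

lemma cyc_winningI:
  assumes "n > 0"
    and "\<And>x. cyc_coloring n h x \<Longrightarrow> \<exists>i\<in>{0..<int n}. g i (x (i - 1)) (x (i + 1)) = x i"
  shows "cyc_winning n h"
  unfolding cyc_winning_def using cyc_strategyI[where g = g, OF assms] by blast

text \<open>
  Wrong guesses make the difference of consecutive colors, taken in $\{0,1,2\}$, weakly increasing,
  hence constant around the cycle. A twist by 1 between the last vertex and vertex 0 is then incompatible
  with 3 dividing $n$.
\<close>

definition rot_guess :: "nat \<Rightarrow> nat \<Rightarrow> nat" where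
  "rot_guess a c = (if c = (a + 1) mod 3 then (a + 1) mod 3 else (a + 2) mod 3)"

lemma less_3_cases: "(a::nat) < 3 \<longleftrightarrow> a = 0 \<or> a = 1 \<or> a = 2"
  by auto

lemma rot_guess_wrong:
  "a < 3 \<Longrightarrow> b < 3 \<Longrightarrow> c < 3 \<Longrightarrow> rot_guess a c \<noteq> b \<Longrightarrow> (b + 3 - a) mod 3 \<le> (c + 3 - b) mod 3"
  unfolding less_3_cases rot_guess_def by (elim disjE) simp_all

lemma cyc_winning_3_dvd:
  assumes n: "n \<ge> 3" and dvd: "3 dvd n" and h: "\<And>i. h i \<le> 3"
  shows "cyc_winning n h"
proof (rule cyc_winningI[where g = "\<lambda>i a c. if i = 0 then rot_guess ((a + 1) mod 3) c
      else if i = int n - 1 then rot_guess a ((c + 2) mod 3) else rot_guess a c"])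
  show "n > 0" using n by simp
  fix x assume x: "cyc_coloring n h x"
  define g where "g = (\<lambda>i a c. if i = 0 then rot_guess ((a + 1) mod 3) c
      else if i = int n - 1 then rot_guess a ((c + 2) mod 3) else rot_guess a c)"
  have x3: "x i < 3" for i
    using x h[of i] unfolding cyc_coloring_def by (meson less_le_trans)
  show "\<exists>i\<in>{0..<int n}. g i (x (i - 1)) (x (i + 1)) = x i"
  proof (rule ccontr)
    assume "\<not> ?thesis"
    then have wrong: "g i (x (i - 1)) (x (i + 1)) \<noteq> x i" if "0 \<le> i" "i < int n" for i
      using that by auto
    \<comment> \<open>Position \<open>n\<close> gets the color of vertex 0 lowered by 1 modulo 3.
      This is the twist: the modified guesses at 0 and \<open>n - 1\<close> are the plain
      \<open>rot_guess\<close> seen across it.\<close>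
    define y where "y k = (if k < n then x (int k) else (x 0 + 2) mod 3)" for k :: nat
    define d where "d k = (y (Suc k) + 3 - y k) mod 3" for k
    have y3: "y k < 3" for k using x3 by (simp add: y_def)
    have mono: "d k \<le> d (Suc k)" if "Suc k < n" for k
    proof -
      have "rot_guess (y k) (y (Suc (Suc k))) \<noteq> y (Suc k)"
      proof (cases "Suc (Suc k) = n")
        case True
        have "x (int n) = x 0" using cyc_coloring_mod_eq[OF x, of "int n" 0] by simp
        then show ?thesis
          using wrong[of "int k + 1"] that True n
          by (auto simp: g_def y_def algebra_simps split: if_splits)
      next
        case False
        then show ?thesis
          using wrong[of "int k + 1"] that by (auto simp: g_def y_def algebra_simps)
      qed
      then show ?thesis unfolding d_def using rot_guess_wrong y3 by blast
    qed
    have "d (n - 1) \<le> d 0"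
    proof -
      have xm: "x (- 1) = x (int (n - 1))"
        using n by (intro cyc_coloring_mod_eq[OF x]) (simp add: of_nat_diff zmod_minus1)
      have "rot_guess ((x (int (n - 1)) + 1) mod 3) (x 1) \<noteq> x 0"
        using wrong[of 0] n xm by (simp add: g_def)
      then have "(x 0 + 3 - (x (int (n - 1)) + 1) mod 3) mod 3 \<le> (x 1 + 3 - x 0) mod 3"
        using rot_guess_wrong[OF _ x3 x3, of "(x (int (n - 1)) + 1) mod 3"] by simp
      moreover have "(x 0 + 3 - (x (int (n - 1)) + 1) mod 3) mod 3 = d (n - 1)"
        using x3[of 0] x3[of "int (n - 1)"] n
        unfolding less_3_cases d_def y_def by (elim disjE) simp_all
      ultimately show ?thesis using n by (simp add: d_def y_def)
    qed
    moreover have le: "d j \<le> d k" if "j \<le> k" "k < n" for j k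
      using that
    proof (induction k rule: dec_induct)
      case (step k)
      then show ?case using mono[of k] by simp
    qed simp
    ultimately have const: "d k = d 0" if "k < n" for k
      using le[of 0 k] le[of k "n - 1"] that by linarith
    have "y k mod 3 = (y 0 + k * d 0) mod 3" if "k \<le> n" for k
      using that
    proof (induction k)
      case (Suc k)
      have "y (Suc k) mod 3 = (y k + d k) mod 3"
        using y3[of k] y3[of "Suc k"] unfolding less_3_cases d_def by (elim disjE) simp_all
      also have "\<dots> = (y 0 + k * d 0 + d 0) mod 3"
        using Suc const[of k] mod_add_left_eq[of "y k" 3 "d 0"]
          mod_add_left_eq[of "y 0 + k * d 0" 3 "d 0"] by simp
      finally show ?case by (simp add: algebra_simps)
    qed simp
    \<comment> \<open>The \<open>n\<close> equal differences add up to a multiple of 3, so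
      \<open>y n\<close> would be \<open>x 0\<close>, whereas it was set to
      \<open>x 0 + 2\<close>.\<close>
    from this[of n] have "(x 0 + 2) mod 3 = (x 0 + n * d 0) mod 3"
      using n by (simp add: y_def)
    moreover have "n * d 0 mod 3 = 0" using dvd by simp
    ultimately have "(x 0 + 2) mod 3 = x 0 mod 3"
      using mod_add_right_eq[of "x 0" "n * d 0" 3] by simp
    then show False using x3[of 0] unfolding less_3_cases by (elim disjE) simp_all
  qed
qed

text \<open>A sporadic strategy: 4 is neither divisible by 3 nor long enough for the rigidity
  argument. Table rows are indexed by the left color, columns by the right one; the proof evaluates
  all 81 colorings.\<close>

lemma cyc_winning_4:
  assumes h: "\<And>i. h i \<le> 3"
  shows "cyc_winning 4 h"
proof (rule cyc_winningI[where g = "\<lambda>i a c.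
     (if i = 0 then [[0,2,1],[2,1,1],[0,0,2]] else if i = 1 then [[2,2,1],[0,1,0],[1,2,0]]
      else if i = 2 then [[1,1,0],[0,1,2],[2,0,2]] else [[1,2,0],[0,2,2],[1,0,1]]) ! a ! c"])
  fix x assume x: "cyc_coloring 4 h x"
  have "x i = 0 \<or> x i = 1 \<or> x i = 2" for i
    using x h[of i] unfolding cyc_coloring_def less_3_cases[symmetric] by (meson less_le_trans)
  note x3 = this[of 0] this[of 1] this[of 2] this[of 3]
  have "x (-1) = x 3" "x 4 = x 0"
    by (rule cyc_coloring_mod_eq[OF x], simp)+
  moreover have "{0..<4} = {0, 1, 2, 3 :: int}" by auto
  ultimately show "\<exists>i\<in>{0..<int 4}. (if i = 0 then [[0,2,1],[2,1,1],[0,0,2]]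
      else if i = 1 then [[2,2,1],[0,1,0],[1,2,0]]
      else if i = 2 then [[1,1,0],[0,1,2],[2,0,2]]
      else [[1,2,0],[0,2,2],[1,0,1]]) ! x (i - 1) ! x (i + 1) = x i"
    using x3 by (elim disjE) (simp_all add: numeral_2_eq_2)
qed simp

text \<open>
  For the triangle: modulo $N = h_0 h_1 h_2$, changing the color of a vertex $v$ moves
  $\sum_u c_u N / h_u$ by multiples of $N / h_v$, so each vertex can be responsible for an interval
  of length $N / h_v$.
\<close>

lemma mod_less_imp_quotient:
  fixes x h w r :: int
  assumes "0 \<le> x" "x < h" "w > 0" and less: "(x * w + r) mod (h * w) < w"
  shows "x = (- (r div w)) mod h"
proof -
  have "(x * w + r) mod (h * w) = w * (((x * w + r) div w) mod h) + (x * w + r) mod w"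
    unfolding mult.commute[of h w] by (rule zmod_zmult2_eq) (use assms in simp)
  also have "(x * w + r) div w = x + r div w"
    using assms by simp
  finally have *: "w * ((x + r div w) mod h) + (x * w + r) mod w < w" using less by simp
  have "(x + r div w) mod h = 0"
  proof (rule ccontr)
    assume "(x + r div w) mod h \<noteq> 0"
    moreover have "(x + r div w) mod h \<ge> 0" using assms by simp
    ultimately have "1 \<le> (x + r div w) mod h" by linarith
    then have "w * 1 \<le> w * ((x + r div w) mod h)"
      using assms by (intro mult_left_mono) auto
    moreover have "(x * w + r) mod w \<ge> 0" using assms by simp
    ultimately show False using * by simp
  qed
  then have "h dvd x - (- (r div w))" by (simp add: mod_eq_0_iff_dvd)
  then have "x mod h = (- (r div w)) mod h" by (simp only: mod_eq_dvd_iff)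
  then show ?thesis using assms by simp
qed

lemma cyc_winning_triangle:
  assumes pos: "h 0 > 0" "h 1 > 0" "h 2 > 0"
    and sum: "h 0 * h 1 * h 2 \<le> h 1 * h 2 + h 0 * h 2 + h 0 * h 1"
  shows "cyc_winning 3 h"
proof -
  define H where "H i = int (h i)" for i
  define w0 w1 w2 where "w0 = H 1 * H 2" and "w1 = H 0 * H 2" and "w2 = H 0 * H 1"
  \<comment> \<open>The three vertices answer for the residues starting at 0, at \<open>w0\<close>
    and at \<open>w0 + w1\<close>, in intervals of length \<open>w0\<close>, \<open>w1\<close>,
    \<open>w2\<close>; the subtracted constants move a vertex's own interval to 0. The first color
    is the left neighbor's, so vertex 0 reads vertex 2 there.\<close>
  define g where "g i a b =
    (if i = 0 then nat ((- ((int b * w1 + int a * w2) div w0)) mod H 0)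
     else if i = 1 then nat ((- ((int a * w0 + int b * w2 - w0) div w1)) mod H 1)
     else nat ((- ((int b * w0 + int a * w1 - w0 - w1) div w2)) mod H 2))" for i :: int and a b
  have H: "H 0 > 0" "H 1 > 0" "H 2 > 0" using pos by (simp_all add: H_def)
  then have w: "w0 > 0" "w1 > 0" "w2 > 0" by (simp_all add: w0_def w1_def w2_def)
  define N where "N = H 0 * H 1 * H 2"
  have N: "N = H 0 * w0" "N = H 1 * w1" "N = H 2 * w2"
    by (simp_all add: N_def w0_def w1_def w2_def)
  have "int (h 0 * h 1 * h 2) \<le> int (h 1 * h 2 + h 0 * h 2 + h 0 * h 1)"
    using sum by (simp only: of_nat_le_iff)
  \<comment> \<open>So the three intervals cover all residues modulo \<open>N\<close>.\<close>
  then have sumN: "N \<le> w0 + w1 + w2" by (simp add: N_def w0_def w1_def w2_def H_def)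
  have Npos: "N > 0" using H by (simp add: N_def)
  show ?thesis
  proof (rule cyc_winningI[where g = g])
    fix x assume x: "cyc_coloring 3 h x"
    then have xh: "int (x i) < H i" for i by (simp add: cyc_coloring_def H_def)
    have per: "x (-1) = x 2" "x 3 = x 0"
      by (rule cyc_coloring_mod_eq[OF x], simp)+
    define s where "s = int (x 0) * w0 + int (x 1) * w1 + int (x 2) * w2"
    have shift: "(s - c) mod N = s mod N - c" if "0 \<le> c" "c \<le> s mod N" for c
    proof -
      have "(s - c) mod N = (s mod N - c) mod N" by (simp add: mod_diff_left_eq)
      also have "\<dots> = s mod N - c"
        using that Npos pos_mod_bound[of N s] by (intro mod_pos_pos_trivial) linarith+
      finally show ?thesis .
    qed
    have "s mod N < N" using Npos by simp
    then consider "s mod N < w0" | "w0 \<le> s mod N" "s mod N < w0 + w1"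
      | "w0 + w1 \<le> s mod N" "s mod N < w0 + w1 + w2"
      using sumN by linarith
    then have "g 0 (x 2) (x 1) = x 0 \<or> g 1 (x 0) (x 2) = x 1 \<or> g 2 (x 1) (x 0) = x 2"
    proof cases
      case 1
      then have "(int (x 0) * w0 + (int (x 1) * w1 + int (x 2) * w2)) mod (H 0 * w0) < w0"
        by (simp add: s_def N(1) add.assoc)
      from mod_less_imp_quotient[OF _ xh w(1) this]
      have "g 0 (x 2) (x 1) = x 0" by (simp add: g_def)
      then show ?thesis by blast
    next
      case 2
      then have "(s - w0) mod N < w1" using shift[of w0] w by simp
      then have "(int (x 1) * w1 + (int (x 0) * w0 + int (x 2) * w2 - w0)) mod (H 1 * w1) < w1"
        by (simp add: s_def N(2) algebra_simps)
      from mod_less_imp_quotient[OF _ xh w(2) this]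
      have "g 1 (x 0) (x 2) = x 1" by (simp add: g_def)
      then show ?thesis by blast
    next
      case 3
      then have "(s - (w0 + w1)) mod N < w2" using shift[of "w0 + w1"] w by simp
      then have "(int (x 2) * w2 + (int (x 0) * w0 + int (x 1) * w1 - w0 - w1)) mod (H 2 * w2) < w2"
        by (simp add: s_def N(3) algebra_simps)
      from mod_less_imp_quotient[OF _ xh w(3) this]
      have "g 2 (x 1) (x 0) = x 2" by (simp add: g_def)
      then show ?thesis by blast
    qed
    moreover have "{0..<3} = {0, 1, 2 :: int}" by auto
    ultimately show "\<exists>i\<in>{0..<int 3}. g i (x (i - 1)) (x (i + 1)) = x i"
      using per by auto
  qed simp
qed

text \<open>The upper bit \<open>c div 2\<close> belongs to the edge on the left, the lower bit
  \<open>c mod 2\<close> to the edge on the right. Left ends guess that the two bits of an edge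
  differ, right ends that they agree. By the last two conclusions nobody reads across the edge
  between positions \<open>n - 1\<close> and 0, so that this edge can be deleted.\<close>

lemma cyc_strategy_2_4_2:
  fixes h :: "int \<Rightarrow> nat" and m :: int
  assumes m: "0 < m" "m < int n" and h0: "h 0 \<le> 2" and hm: "h m \<le> 2"
    and h4: "\<And>k. 0 < k \<Longrightarrow> k < m \<Longrightarrow> h k \<le> 4"
  obtains f where "cyc_strategy n h f"
    and "\<And>i a b b'. i mod int n = int n - 1 \<Longrightarrow> f i a b = f i a b'"
    and "\<And>i a a' b. i mod int n = 0 \<Longrightarrow> f i a b = f i a' b"
proof -
  \<comment> \<open>The end at \<open>m\<close> has hatness at most 2, so its color is itself the
    bit of its left edge.\<close>
  define X where "X i c = (if i = m then c else c div 2)" for i and c :: nat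
  define g where "g i a b = (if i = 0 then 1 - X 1 b
      else if i < m then 2 * (a mod 2) + (1 - X (i + 1) b)
      else if i = m then a mod 2 else 0)" for i and a b :: nat
  have "cyc_strategy n h (\<lambda>i. g (i mod int n))"
  proof (rule cyc_strategyI)
    show "n > 0" using m by simp
    fix x assume x: "cyc_coloring n h x"
    then have xh: "x i < h i" for i by (simp add: cyc_coloring_def)
    have x0: "x 0 < 2" and xm: "x m < 2" using xh[of 0] xh[of m] h0 hm by linarith+
    have x4: "x k < 4" if "0 < k" "k < m" for k using xh[of k] h4[OF that] by linarith
    have X2: "X k (x k) < 2" if "0 < k" "k \<le> m" for k
      using xm x4[of k] that by (auto simp: X_def)
    show "\<exists>i\<in>{0..<int n}. g i (x (i - 1)) (x (i + 1)) = x i"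
    proof (rule ccontr)
      assume "\<not> ?thesis"
      then have wrong: "g i (x (i - 1)) (x (i + 1)) \<noteq> x i" if "0 \<le> i" "i < int n" for i
        using that by auto
      \<comment> \<open>At vertex \<open>k + 1\<close> the left bit is guessed right by induction,
        so the error is in the right bit. Thus the bits agree along every edge, which is what vertex
        \<open>m\<close> guesses.\<close>
      have chain: "x k mod 2 = X (k + 1) (x (k + 1))" if "0 \<le> k" "k < m" for k
        using that
      proof (induction k rule: int_ge_induct)
        case base
        have "1 - X 1 (x 1) \<noteq> x 0" using wrong[of 0] m by (simp add: g_def)
        then show ?case using x0 X2[of 1] m by auto
      next
        case (step k)
        have "2 * (x k mod 2) + (1 - X (k + 2) (x (k + 2))) \<noteq> x (k + 1)"
          using wrong[of "k + 1"] step m by (simp add: g_def add.commute)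
        moreover have "x (k + 1) div 2 = x k mod 2" using step by (simp add: X_def)
        ultimately have "x (k + 1) mod 2 \<noteq> 1 - X (k + 2) (x (k + 2))"
          by (metis div_mult_mod_eq mult.commute)
        then show ?case using X2[of "k + 2"] step by (simp add: add.commute)
      qed
      have "x (m - 1) mod 2 = x m" using chain[of "m - 1"] m by (simp add: X_def)
      moreover have "x (m - 1) mod 2 \<noteq> x m" using wrong[of m] m by (simp add: g_def)
      ultimately show False by simp
    qed
  qed
  moreover have "g (i mod int n) a b = g (i mod int n) a b'" if "i mod int n = int n - 1" for i a b b'
    using that m by (auto simp: g_def)
  moreover have "g (i mod int n) a b = g (i mod int n) a' b" if "i mod int n = 0" for i a a' b
    using that by (simp add: g_def)
  ultimately show thesis by (rule that)
qed

text \<open>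
  A chain of vertices of hatness 4 shows one bit $s$ to vertex 2 and one bit $t$ to vertex 0. It rules out
  the case $s = \varphi(c)$ and $t = \psi(a)$, for functions $\varphi$, $\psi$ of our choice.
\<close>

lemma cyc_winning_core_4_chain:
  fixes h :: "int \<Rightarrow> nat" and \<phi> \<psi> :: "nat \<Rightarrow> nat"
  assumes n: "n \<ge> 4" and h4: "\<And>k. 3 \<le> k \<Longrightarrow> k < int n \<Longrightarrow> h k \<le> 4"
    and bits: "\<And>a. \<phi> a < 2" "\<And>a. \<psi> a < 2"
    and core: "\<And>a b c s t. a < h 0 \<Longrightarrow> b < h 1 \<Longrightarrow> c < h 2 \<Longrightarrow> s < 2 \<Longrightarrow> t < 2 \<Longrightarrow>
      \<not> (s = \<phi> c \<and> t = \<psi> a) \<Longrightarrow> fa t b = a \<or> fb a c = b \<or> fc b s = c"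
  shows "cyc_winning n h"
proof (rule cyc_winningI)
  show "n > 0" using n by simp
  \<comment> \<open>Vertex 2 reads only the upper bit of vertex 3, vertex 0 only the lower bit of
    vertex \<open>n - 1\<close>. The outer bits of the chain are guessed to be \<open>\<phi>\<close>
    and \<open>\<psi>\<close> of the adjacent color; for \<open>n = 4\<close> vertex 3 is both ends
    of the chain.\<close>
  define g where "g i a b = (if i = 0 then fa (a mod 2) b else if i = 1 then fb a b
      else if i = 2 then fc a (b div 2)
      else 2 * (if i = 3 then \<phi> a else a mod 2) + (if i = int n - 1 then \<psi> b else 1 - b div 2))"
    for i :: int and a b :: nat
  fix x assume x: "cyc_coloring n h x"
  then have xh: "x i < h i" for i by (simp add: cyc_coloring_def)
  have x4: "x k < 4" if "3 \<le> k" "k < int n" for k using xh[of k] h4[OF that] by linarith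
  have per: "x (- 1) = x (int n - 1)" "x (int n) = x 0"
    using n by (auto intro!: cyc_coloring_mod_eq[OF x] simp: zmod_minus1)
  show "\<exists>i\<in>{0..<int n}. g i (x (i - 1)) (x (i + 1)) = x i"
  proof (rule ccontr)
    assume "\<not> ?thesis"
    then have wrong: "g i (x (i - 1)) (x (i + 1)) \<noteq> x i" if "0 \<le> i" "i < int n" for i
      using that by auto
    \<comment> \<open>Once the first upper bit is guessed right, each vertex must err in its lower
      bit, and then the next upper bit is guessed right. The last vertex can then be wrong only if
      its lower bit is not \<open>\<psi> (x 0)\<close>.\<close>
    have chain: "x k div 2 = (if k = 3 then \<phi> (x 2) else x (k - 1) mod 2)"
      if start: "x 3 div 2 = \<phi> (x 2)" and "3 \<le> k" "k < int n" for k
      using that(2,3)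
    proof (induction k rule: int_ge_induct)
      case base
      then show ?case using start by simp
    next
      case (step k)
      have "x k div 2 = (if k = 3 then \<phi> (x 2) else x (k - 1) mod 2)" using step by simp
      moreover have "2 * (if k = 3 then \<phi> (x (k - 1)) else x (k - 1) mod 2) + (1 - x (k + 1) div 2) \<noteq> x k"
        using wrong[of k] step by (simp add: g_def)
      ultimately have "2 * (x k div 2) + (1 - x (k + 1) div 2) \<noteq> x k"
        by (auto split: if_splits)
      then have "x k mod 2 \<noteq> 1 - x (k + 1) div 2" by (metis div_mult_mod_eq mult.commute)
      moreover have "x (k + 1) div 2 < 2" using x4[of "k + 1"] step by simp
      ultimately have "x (k + 1) div 2 = x k mod 2" by linarith
      then show ?case using step by simp
    qed
    have "\<not> (x 3 div 2 = \<phi> (x 2) \<and> x (int n - 1) mod 2 = \<psi> (x 0))"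
    proof
      assume *: "x 3 div 2 = \<phi> (x 2) \<and> x (int n - 1) mod 2 = \<psi> (x 0)"
      define k where "k = int n - 1"
      have "x k div 2 = (if k = 3 then \<phi> (x 2) else x (k - 1) mod 2)"
        using chain[of k] * n by (simp add: k_def)
      moreover have "2 * (if k = 3 then \<phi> (x (k - 1)) else x (k - 1) mod 2) + \<psi> (x 0) \<noteq> x k"
      proof -
        have k: "3 \<le> k" "k < int n" "k = int n - 1" using n by (simp_all add: k_def)
        then have "g k u v = 2 * (if k = 3 then \<phi> u else u mod 2) + \<psi> v" for u v
          unfolding g_def by auto
        moreover have "x (k + 1) = x 0" using per by (simp add: k_def)
        moreover have "g k (x (k - 1)) (x (k + 1)) \<noteq> x k" by (rule wrong) (use k in auto)
        ultimately show ?thesis by simp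
      qed
      ultimately have "2 * (x k div 2) + \<psi> (x 0) \<noteq> x k" by (auto split: if_splits)
      moreover have "x k mod 2 = \<psi> (x 0)" using * by (simp add: k_def)
      ultimately show False by (metis div_mult_mod_eq mult.commute)
    qed
    moreover have "x 3 div 2 < 2" using x4[of 3] n by simp
    moreover have "x (int n - 1) mod 2 < 2" by simp
    ultimately have "fa (x (int n - 1) mod 2) (x 1) = x 0 \<or> fb (x 0) (x 2) = x 1
        \<or> fc (x 1) (x 3 div 2) = x 2"
      using core xh by blast
    then show False
      using wrong[of 0] wrong[of 1] wrong[of 2] n per by (auto simp: g_def)
  qed
qed

text \<open>Of the 72 tuples of three colors and two bits, 18 satisfy both
  \<open>s = \<phi> c\<close> and \<open>t = \<psi> a\<close> and are left to the chain; the tables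
  of the three core vertices settle the other 54. The numbers are the same for the order 3, 2,
  3.\<close>

lemma cyc_winning_2_3_3:
  assumes n: "n \<ge> 4" and h: "h 0 = 2" "h 1 = 3" "h 2 = 3"
    and h4: "\<And>k. h k \<le> 4"
  shows "cyc_winning n h"
proof (rule cyc_winning_core_4_chain[OF n h4, where \<phi> = "\<lambda>c. if c = 1 then 0 else 1"
      and \<psi> = "\<lambda>a. if a = 0 then 1 else 0" and fa = "\<lambda>t b. [[1,0,0],[1,1,0]] ! t ! b"
      and fb = "\<lambda>a c. [[0,0,1],[2,2,1]] ! a ! c" and fc = "\<lambda>b s. [[2,2],[0,1],[2,2]] ! b ! s"])
  fix a b c s t :: nat
  assume "a < h 0" "b < h 1" "c < h 2" "s < 2" "t < 2"
    and "\<not> (s = (if c = 1 then 0 else 1) \<and> t = (if a = 0 then 1 else 0))"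
  then show "[[1,0,0],[1,1,0]] ! t ! b = a \<or> [[0,0,1],[2,2,1]] ! a ! c = b
      \<or> [[2,2],[0,1],[2,2]] ! b ! s = c"
    unfolding h less_3_cases less_2_cases_iff by (elim disjE) (simp_all add: numeral_2_eq_2)
qed auto

lemma cyc_winning_3_2_3:
  assumes n: "n \<ge> 4" and h: "h 0 = 3" "h 1 = 2" "h 2 = 3"
    and h4: "\<And>k. h k \<le> 4"
  shows "cyc_winning n h"
proof (rule cyc_winning_core_4_chain[OF n h4, where \<phi> = "\<lambda>c. if c = 0 then 1 else 0"
      and \<psi> = "\<lambda>a. if a = 0 then 0 else 1" and fa = "\<lambda>t b. [[2,1],[2,0]] ! t ! b"
      and fb = "\<lambda>a c. [[0,1,0],[0,1,0],[1,1,1]] ! a ! c" and fc = "\<lambda>b s. [[1,1],[0,2]] ! b ! s"])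
  fix a b c s t :: nat
  assume "a < h 0" "b < h 1" "c < h 2" "s < 2" "t < 2"
    and "\<not> (s = (if c = 0 then 1 else 0) \<and> t = (if a = 0 then 0 else 1))"
  then show "[[2,1],[2,0]] ! t ! b = a \<or> [[0,1,0],[0,1,0],[1,1,1]] ! a ! c = b
      \<or> [[1,1],[0,2]] ! b ! s = c"
    unfolding h less_3_cases less_2_cases_iff by (elim disjE) (simp_all add: numeral_2_eq_2)
qed auto

section \<open>Walks of wrong guesses\<close>

text \<open>Vertex \<open>k + 1\<close> is tested only when the color at \<open>k + 2\<close> is
  chosen. So \<open>walk h f a b k u v\<close> has tested vertices 1 to \<open>k\<close>, while the
  guesses at 0 and at \<open>k + 1\<close> are still open.\<close>

inductive walk :: "(int \<Rightarrow> nat) \<Rightarrow> (int \<Rightarrow> nat \<Rightarrow> nat \<Rightarrow> nat) \<Rightarrow> nat \<Rightarrow> nat \<Rightarrow> int \<Rightarrow> nat \<Rightarrow> nat \<Rightarrow> bool"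
  for h f a b where
  walk_start: "walk h f a b 0 a b"
| walk_step: "walk h f a b k u v \<Longrightarrow> w < h (k + 2) \<Longrightarrow> f (k + 1) u w \<noteq> v \<Longrightarrow> walk h f a b (k + 1) v w"

lemma walk_imp_path:
  assumes "walk h f a b k u v" "a < h 0" "b < h 1"
  shows "0 \<le> k \<and> (\<exists>x. x 0 = a \<and> x 1 = b \<and> x k = u \<and> x (k + 1) = v
    \<and> (\<forall>i. 0 \<le> i \<and> i \<le> k + 1 \<longrightarrow> x i < h i)
    \<and> (\<forall>i. 1 \<le> i \<and> i \<le> k \<longrightarrow> f i (x (i - 1)) (x (i + 1)) \<noteq> x i))"
  using assms(1)
proof induction
  case walk_start
  show ?case
  proof (intro conjI exI[of _ "\<lambda>i. if i = 0 then a else b"] allI impI)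
    fix i :: int assume "0 \<le> i \<and> i \<le> 0 + 1"
    then have "i = 0 \<or> i = 1" by auto
    then show "(if i = 0 then a else b) < h i" using assms by auto
  qed auto
next
  case (walk_step k u v w)
  then obtain x where k: "0 \<le> k" and x: "x 0 = a" "x 1 = b" "x k = u" "x (k + 1) = v"
    "\<And>i. 0 \<le> i \<Longrightarrow> i \<le> k + 1 \<Longrightarrow> x i < h i"
    "\<And>i. 1 \<le> i \<Longrightarrow> i \<le> k \<Longrightarrow> f i (x (i - 1)) (x (i + 1)) \<noteq> x i"
    by auto
  define y where "y = x(k + 2 := w)"
  have y: "y i = x i" if "i \<le> k + 1" for i using that by (simp add: y_def)
  have "f i (y (i - 1)) (y (i + 1)) \<noteq> y i" if "1 \<le> i" "i \<le> k + 1" for i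
  proof (cases "i = k + 1")
    case True
    then show ?thesis using walk_step x y by (simp add: y_def add.commute)
  next
    case False
    then show ?thesis using x(6)[of i] y that by simp
  qed
  moreover have "y i < h i" if "0 \<le> i" "i \<le> k + 2" for i
    using that x(5)[of i] walk_step by (simp add: y_def)
  ultimately show ?case
    using k x y by (intro conjI exI[of _ y]) (auto simp: y_def)
qed

text \<open>
  Once the next color $d$ is fixed, a color $c$ of vertex $k + 1$ dies only if it is the guess at $(p, d)$ for
  every $p$ from which $c$ was reached. So two suitable colors $p, q$ kill at most two colors, and two out of
  three kill at most one.
\<close>

definition weak :: "(int \<Rightarrow> nat) \<Rightarrow> (int \<Rightarrow> nat \<Rightarrow> nat \<Rightarrow> nat) \<Rightarrow> nat \<Rightarrow> nat \<Rightarrow> int \<Rightarrow> bool" where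
  "weak h f a b k \<longleftrightarrow> (\<exists>p q. \<forall>c<h (k + 1). walk h f a b k p c \<or> walk h f a b k q c)"

definition strong :: "(int \<Rightarrow> nat) \<Rightarrow> (int \<Rightarrow> nat \<Rightarrow> nat \<Rightarrow> nat) \<Rightarrow> nat \<Rightarrow> nat \<Rightarrow> int \<Rightarrow> bool" where
  "strong h f a b k \<longleftrightarrow> (\<exists>p q r. \<forall>c<h (k + 1).
     walk h f a b k p c \<and> walk h f a b k q c \<or> walk h f a b k p c \<and> walk h f a b k r c
     \<or> walk h f a b k q c \<and> walk h f a b k r c)"

lemma walk_step':
  assumes "walk h f a b k u c" "d < h (k + 2)"
  shows "walk h f a b (k + 1) c d \<or> f (k + 1) u d = c"
  using walk_step[of h f a b k u c d] assms by blast

lemma weak_survivors: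
  assumes "weak h f a b k" "d < h (k + 2)"
  obtains e1 e2 where "\<And>c. c < h (k + 1) \<Longrightarrow> c \<noteq> e1 \<Longrightarrow> c \<noteq> e2 \<Longrightarrow> walk h f a b (k + 1) c d"
proof -
  obtain p q where pq: "\<And>c. c < h (k + 1) \<Longrightarrow> walk h f a b k p c \<or> walk h f a b k q c"
    using assms(1) unfolding weak_def by blast
  have "walk h f a b (k + 1) c d" if "c < h (k + 1)" "c \<noteq> f (k + 1) p d" "c \<noteq> f (k + 1) q d" for c
    using pq[OF that(1)] walk_step'[of h f a b k _ c d] assms(2) that(2,3) by metis
  then show thesis using that by blast
qed

lemma strong_survivors:
  assumes "strong h f a b k" "d < h (k + 2)"
  obtains e where "\<And>c. c < h (k + 1) \<Longrightarrow> c \<noteq> e \<Longrightarrow> walk h f a b (k + 1) c d"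
proof -
  obtain p q r where pqr: "\<And>c. c < h (k + 1) \<Longrightarrow>
     walk h f a b k p c \<and> walk h f a b k q c \<or> walk h f a b k p c \<and> walk h f a b k r c
     \<or> walk h f a b k q c \<and> walk h f a b k r c"
    using assms(1) unfolding strong_def by blast
  have "c = c'" if "c < h (k + 1)" "c' < h (k + 1)"
    "\<not> walk h f a b (k + 1) c d" "\<not> walk h f a b (k + 1) c' d" for c c'
    using pqr[OF that(1)] pqr[OF that(2)] that(3,4)
      walk_step'[of h f a b k _ c d] walk_step'[of h f a b k _ c' d] assms(2) by metis
  then show thesis using that by metis
qed

text \<open>For fixed \<open>d\<close> the guess \<open>f (k + 1) u d\<close> is a single color, so
  of two colors reached from the same \<open>u\<close> at most one fails to continue to
  \<open>d\<close>. The two serve as \<open>p\<close>, \<open>q\<close> one position later.\<close>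

lemma weakI:
  assumes "walk h f a b k u c" "walk h f a b k u c'" "c \<noteq> c'"
  shows "weak h f a b (k + 1)"
  unfolding weak_def
proof (intro exI allI impI)
  fix d assume "d < h (k + 1 + 1)"
  then have d: "d < h (k + 2)" by (simp add: add.assoc)
  show "walk h f a b (k + 1) c d \<or> walk h f a b (k + 1) c' d"
    using walk_step'[OF assms(1) d] walk_step'[OF assms(2) d] assms(3) by auto
qed

lemma strongI:
  assumes "walk h f a b k u c" "walk h f a b k u c'" "walk h f a b k u c''"
    "c \<noteq> c'" "c \<noteq> c''" "c' \<noteq> c''"
  shows "strong h f a b (k + 1)"
  unfolding strong_def
proof (intro exI allI impI)
  fix d assume "d < h (k + 1 + 1)"
  then have d: "d < h (k + 2)" by (simp add: add.assoc)
  show "walk h f a b (k + 1) c d \<and> walk h f a b (k + 1) c' d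
    \<or> walk h f a b (k + 1) c d \<and> walk h f a b (k + 1) c'' d
    \<or> walk h f a b (k + 1) c' d \<and> walk h f a b (k + 1) c'' d"
    using walk_step'[OF assms(1) d] walk_step'[OF assms(2) d] walk_step'[OF assms(3) d] assms(4-)
    by auto
qed

text \<open>Pigeonhole: of three colors reached from two predecessors, two share one.\<close>

lemma weak_step:
  assumes "weak h f a b k" "h (k + 1) \<ge> 3"
  shows "weak h f a b (k + 1)"
proof -
  obtain p q where pq: "\<And>c. c < h (k + 1) \<Longrightarrow> walk h f a b k p c \<or> walk h f a b k q c"
    using assms(1) unfolding weak_def by blast
  have "0 < h (k + 1)" "1 < h (k + 1)" "2 < h (k + 1)" using assms(2) by auto
  from this[THEN pq] show ?thesis
    using weakI[of h f a b k _ 0 1] weakI[of h f a b k _ 0 2] weakI[of h f a b k _ 1 2] by auto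
qed

text \<open>Of five colors reached from two predecessors, three share one. This is the origin of the
  threshold 5: four colors can split evenly.\<close>

lemma weak_step_strong:
  assumes "weak h f a b k" "h (k + 1) \<ge> 5"
  shows "strong h f a b (k + 1)"
proof -
  obtain p q where pq: "\<And>c. c < h (k + 1) \<Longrightarrow> walk h f a b k p c \<or> walk h f a b k q c"
    using assms(1) unfolding weak_def by blast
  define P Q where "P = {c. c < 5 \<and> walk h f a b k p c}" and "Q = {c. c < 5 \<and> walk h f a b k q c}"
  have "{..<5} \<subseteq> P \<union> Q"
  proof
    fix c :: nat assume "c \<in> {..<5}"
    then show "c \<in> P \<union> Q" using pq[of c] assms(2) by (auto simp: P_def Q_def)
  qed
  then have "card {..<5::nat} \<le> card (P \<union> Q)"
    by (intro card_mono) (auto simp: P_def Q_def)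
  also have "\<dots> \<le> card P + card Q" by (rule card_Un_le)
  finally have "3 \<le> card P \<or> 3 \<le> card Q" by auto
  then obtain s where "3 \<le> card {c. c < 5 \<and> walk h f a b k s c}"
    unfolding P_def Q_def by blast
  then obtain T where "T \<subseteq> {c. c < 5 \<and> walk h f a b k s c}" "card T = 3"
    by (meson obtain_subset_with_card_n)
  then obtain c c' c'' where "walk h f a b k s c" "walk h f a b k s c'" "walk h f a b k s c''"
    "c \<noteq> c'" "c \<noteq> c''" "c' \<noteq> c''"
    by (auto simp: card_3_iff)
  then show ?thesis by (rule strongI)
qed

text \<open>For each next color at most one of 0, 1, 2 dies, so these three form the new
  triple.\<close>

lemma strong_step:
  assumes "strong h f a b k" "h (k + 1) \<ge> 3"
  shows "strong h f a b (k + 1)"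
  unfolding strong_def
proof (intro exI allI impI)
  fix d assume "d < h (k + 1 + 1)"
  then have d: "d < h (k + 2)" by (simp add: add.assoc)
  obtain e where e: "\<And>c. c < h (k + 1) \<Longrightarrow> c \<noteq> e \<Longrightarrow> walk h f a b (k + 1) c d"
    using strong_survivors[OF assms(1) d] by blast
  show "walk h f a b (k + 1) 0 d \<and> walk h f a b (k + 1) 1 d
    \<or> walk h f a b (k + 1) 0 d \<and> walk h f a b (k + 1) 2 d
    \<or> walk h f a b (k + 1) 1 d \<and> walk h f a b (k + 1) 2 d"
    using e[of 0] e[of 1] e[of 2] assms(2) by (cases "e = 0"; cases "e = 1") auto
qed

lemma strong_step_weak:
  assumes "strong h f a b k" "h (k + 1) \<ge> 2"
  shows "weak h f a b (k + 1)"
  unfolding weak_def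
proof (intro exI allI impI)
  fix d assume "d < h (k + 1 + 1)"
  then have d: "d < h (k + 2)" by (simp add: add.assoc)
  obtain e where e: "\<And>c. c < h (k + 1) \<Longrightarrow> c \<noteq> e \<Longrightarrow> walk h f a b (k + 1) c d"
    using strong_survivors[OF assms(1) d] by blast
  show "walk h f a b (k + 1) 0 d \<or> walk h f a b (k + 1) 1 d"
    using e[of 0] e[of 1] assms(2) by (cases "e = 0") auto
qed

lemma weak_steps:
  assumes "k \<le> l" "weak h f a b k" "\<And>j. k < j \<Longrightarrow> j \<le> l \<Longrightarrow> h j \<ge> 3"
  shows "weak h f a b l"
  using assms(1,3)
proof (induction l rule: int_ge_induct)
  case (step l)
  then show ?case using weak_step[of h f a b l] by simp
qed (rule assms(2))

lemma strong_steps: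
  assumes "k \<le> l" "strong h f a b k" "\<And>j. k < j \<Longrightarrow> j \<le> l \<Longrightarrow> h j \<ge> 3"
  shows "strong h f a b l"
  using assms(1,3)
proof (induction l rule: int_ge_induct)
  case (step l)
  then show ?case using strong_step[of h f a b l] by simp
qed (rule assms(2))

section \<open>Counting the walks that close up\<close>

locale cyc_game =
  fixes n :: nat and h :: "int \<Rightarrow> nat" and f :: "int \<Rightarrow> nat \<Rightarrow> nat \<Rightarrow> nat"
  assumes n: "n \<ge> 4" and h_per: "\<And>i. h (i + int n) = h i" and strategy: "cyc_strategy n h f"
begin

abbreviation "W \<equiv> walk h f"

text \<open>
  The closing pairs for \<open>a\<close> are counted by \<open>N\<close> row by row; a row is small only if many colors of
  vertex 2 make vertex 1 guess \<open>b\<close>, and \<open>K\<close> counts those.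
\<close>

definition N :: "nat \<Rightarrow> nat \<Rightarrow> nat" where
  "N a b = card {v. v < h (- 1) \<and> W a b (int n - 1) v a}"

definition K :: "nat \<Rightarrow> nat \<Rightarrow> nat" where
  "K a b = card {c. c < h 2 \<and> f 1 a c = b}"

lemma h_mod: "i mod int n = j mod int n \<Longrightarrow> h i = h j"
  by (rule periodic_mod_eq[of h "int n"]) (simp_all add: h_per)

lemma h_last: "h (int n - 1) = h (- 1)"
  using h_per[of "- 1"] by simp

lemma walk_closed:
  assumes "a < h 0" "b < h 1" "W a b (int n - 1) v a"
  shows "f 0 v b = a"
proof (rule ccontr)
  assume neq: "f 0 v b \<noteq> a"
  obtain x where x: "x 0 = a" "x 1 = b" "x (int n - 1) = v" "x (int n) = a"
    "\<And>i. 0 \<le> i \<Longrightarrow> i \<le> int n \<Longrightarrow> x i < h i"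
    "\<And>i. 1 \<le> i \<Longrightarrow> i \<le> int n - 1 \<Longrightarrow> f i (x (i - 1)) (x (i + 1)) \<noteq> x i"
    using walk_imp_path[OF assms(3,1,2)] by auto
  define y where "y i = x (i mod int n)" for i
  have "cyc_coloring n h y"
    unfolding cyc_coloring_def
  proof (intro conjI allI)
    fix i
    have "i mod int n < int n" "0 \<le> i mod int n" using n by simp_all
    moreover have "h (i mod int n) = h i" by (rule h_mod) simp
    ultimately show "y i < h i" using x(5)[of "i mod int n"] by (simp add: y_def)
  qed (simp add: y_def)
  then obtain i where i: "f i (y (i - 1)) (y (i + 1)) = y i"
    using strategy unfolding cyc_strategy_def by blast
  define j where "j = i mod int n"
  have j: "0 \<le> j" "j < int n" using n by (simp_all add: j_def)
  have "f j = f i" by (rule cyc_strategy_mod_eq[OF strategy]) (simp add: j_def)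
  moreover have "y (j - 1) = y (i - 1)" "y (j + 1) = y (i + 1)" "y j = y i"
    by (simp_all add: y_def j_def mod_diff_left_eq mod_add_left_eq)
  ultimately have fj: "f j (y (j - 1)) (y (j + 1)) = y j" using i by simp
  show False
  proof (cases "j = 0")
    case True
    have "y (- 1) = v" using n x by (simp add: y_def zmod_minus1)
    then show ?thesis using fj True neq n x by (simp add: y_def)
  next
    case False
    have "y (j + 1) = x (j + 1)"
      using j x by (cases "j + 1 = int n") (simp_all add: y_def)
    then show ?thesis using fj x(6)[of j] j False by (simp add: y_def)
  qed
qed

lemma sum_N_le:
  assumes "b < h 1"
  shows "(\<Sum>a<h 0. N a b) \<le> h (- 1)"
proof -
  have "(\<Sum>a<h 0. N a b) \<le> (\<Sum>a<h 0. card {v. v < h (- 1) \<and> f 0 v b = a})"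
    unfolding N_def using walk_closed[OF _ assms] by (intro sum_mono card_mono) auto
  also have "\<dots> = card (\<Union>a<h 0. {v. v < h (- 1) \<and> f 0 v b = a})"
    by (subst card_UN_disjoint) auto
  also have "\<dots> \<le> card {..<h (- 1)}" by (intro card_mono) auto
  finally show ?thesis by simp
qed

lemma sum_K_le: "(\<Sum>b<m. K a b) \<le> h 2"
proof -
  have "(\<Sum>b<m. K a b) = card (\<Union>b<m. {c. c < h 2 \<and> f 1 a c = b})"
    unfolding K_def by (subst card_UN_disjoint) auto
  also have "\<dots> \<le> card {..<h 2}" by (intro card_mono) auto
  finally show ?thesis by simp
qed

lemma walk_1: "c < h 2 \<Longrightarrow> f 1 a c \<noteq> b \<Longrightarrow> W a b 1 b c"
  using walk_step[OF walk_start, where h = h and f = f and a = a and b = b and w = c] by simp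

lemma card_allowed: "card {c. c < h 2 \<and> f 1 a c \<noteq> b} + K a b = h 2"
proof -
  have "card {..<h 2} = card ({c. c < h 2 \<and> f 1 a c \<noteq> b} \<union> {c. c < h 2 \<and> f 1 a c = b})"
    by (intro arg_cong[of _ _ card]) auto
  also have "\<dots> = card {c. c < h 2 \<and> f 1 a c \<noteq> b} + K a b"
    unfolding K_def by (intro card_Un_disjoint) auto
  finally show ?thesis by simp
qed

lemma weak_2:
  assumes "K a b + 2 \<le> h 2"
  shows "weak h f a b 2"
proof -
  have "2 \<le> card {c. c < h 2 \<and> f 1 a c \<noteq> b}" using card_allowed[of a b] assms by linarith
  then obtain T where "T \<subseteq> {c. c < h 2 \<and> f 1 a c \<noteq> b}" "card T = 2"
    by (meson obtain_subset_with_card_n)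
  then obtain c c' where "c < h 2" "f 1 a c \<noteq> b" "c' < h 2" "f 1 a c' \<noteq> b" "c \<noteq> c'"
    by (auto simp: card_2_iff)
  then have "weak h f a b (1 + 1)" using weakI[OF walk_1 walk_1] by blast
  then show ?thesis by simp
qed

lemma strong_2:
  assumes "K a b + 3 \<le> h 2"
  shows "strong h f a b 2"
proof -
  have "3 \<le> card {c. c < h 2 \<and> f 1 a c \<noteq> b}" using card_allowed[of a b] assms by linarith
  then obtain T where "T \<subseteq> {c. c < h 2 \<and> f 1 a c \<noteq> b}" "card T = 3"
    by (meson obtain_subset_with_card_n)
  then obtain c c' c'' where c: "c < h 2" "f 1 a c \<noteq> b" "c' < h 2" "f 1 a c' \<noteq> b"
    "c'' < h 2" "f 1 a c'' \<noteq> b" and neq: "c \<noteq> c'" "c \<noteq> c''" "c' \<noteq> c''"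
    by (auto simp: card_3_iff)
  have "strong h f a b (1 + 1)"
    by (rule strongI[OF walk_1[OF c(1,2)] walk_1[OF c(3,4)] walk_1[OF c(5,6)] neq])
  then show ?thesis by simp
qed

text \<open>After position \<open>n - 1\<close> the color is prescribed: it is \<open>a\<close>, as
  vertex 0 is reached again. For one prescribed color the weak guarantee loses at most two colors of
  vertex \<open>n - 1\<close>.\<close>

lemma N_weak:
  assumes "weak h f a b (int n - 2)" "a < h 0"
  shows "h (- 1) \<le> N a b + 2"
proof -
  have "a < h (int n - 2 + 2)" using assms(2) h_per[of 0] by simp
  then obtain e1 e2 where "\<And>c. c < h (int n - 1) \<Longrightarrow> c \<noteq> e1 \<Longrightarrow> c \<noteq> e2 \<Longrightarrow> W a b (int n - 1) c a"
    using weak_survivors[OF assms(1) \<open>a < h (int n - 2 + 2)\<close>] by auto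
  then have "{..<h (- 1)} - {e1, e2} \<subseteq> {v. v < h (- 1) \<and> W a b (int n - 1) v a}"
    by (auto simp: h_last)
  then have "card ({..<h (- 1)} - {e1, e2}) \<le> N a b" unfolding N_def by (intro card_mono) auto
  moreover have "card {..<h (- 1)} - card {e1, e2} \<le> card ({..<h (- 1)} - {e1, e2})"
    by (rule diff_card_le_card_Diff) simp
  moreover have "card {e1, e2} \<le> 2" by (cases "e1 = e2") auto
  ultimately show ?thesis by simp
qed

lemma N_strong:
  assumes "strong h f a b (int n - 2)" "a < h 0"
  shows "h (- 1) \<le> N a b + 1"
proof -
  have "a < h (int n - 2 + 2)" using assms(2) h_per[of 0] by simp
  then obtain e where "\<And>c. c < h (int n - 1) \<Longrightarrow> c \<noteq> e \<Longrightarrow> W a b (int n - 1) c a"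
    using strong_survivors[OF assms(1) \<open>a < h (int n - 2 + 2)\<close>] by auto
  then have "{..<h (- 1)} - {e} \<subseteq> {v. v < h (- 1) \<and> W a b (int n - 1) v a}"
    by (auto simp: h_last)
  then have "card ({..<h (- 1)} - {e}) \<le> N a b" unfolding N_def by (intro card_mono) auto
  moreover have "card {..<h (- 1)} - card {e} \<le> card ({..<h (- 1)} - {e})"
    by (rule diff_card_le_card_Diff) simp
  ultimately show ?thesis by simp
qed

lemma N_weak_3:
  assumes "\<And>j. 2 < j \<Longrightarrow> j < int n - 1 \<Longrightarrow> h j \<ge> 3" "K a b + 2 \<le> h 2" "a < h 0"
  shows "h (- 1) \<le> N a b + 2"
proof -
  have "weak h f a b (int n - 2)"
    using weak_steps[OF _ weak_2[OF assms(2)], of "int n - 2"] assms(1) n by simp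
  then show ?thesis using assms(3) by (rule N_weak)
qed

lemma N_strong_3:
  assumes "\<And>j. 2 < j \<Longrightarrow> j < int n - 1 \<Longrightarrow> h j \<ge> 3" "K a b + 3 \<le> h 2" "a < h 0"
  shows "h (- 1) \<le> N a b + 1"
proof -
  have "strong h f a b (int n - 2)"
    using strong_steps[OF _ strong_2[OF assms(2)], of "int n - 2"] assms(1) n by simp
  then show ?thesis using assms(3) by (rule N_strong)
qed

end

section \<open>Losing by counting\<close>

lemma sum_lessThan_3: "(\<Sum>a<3. g a) = g 0 + g 1 + g (2::nat)" for g :: "nat \<Rightarrow> nat"
  by (simp add: eval_nat_numeral lessThan_Suc)

lemma sum_lessThan_2: "(\<Sum>a<2. g a) = g 0 + g (1::nat)" for g :: "nat \<Rightarrow> nat"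
  by (simp add: eval_nat_numeral lessThan_Suc)

lemma sum_lessThan_4: "(\<Sum>a<4. g a) = g 0 + g 1 + g 2 + g (3::nat)" for g :: "nat \<Rightarrow> nat"
  by (simp add: eval_nat_numeral lessThan_Suc)

lemma sum_lessThan_5: "(\<Sum>a<5. g a) = g 0 + g 1 + g 2 + g 3 + g (4::nat)" for g :: "nat \<Rightarrow> nat"
  by (simp add: eval_nat_numeral lessThan_Suc)

context cyc_game
begin

text \<open>If vertex 1 guesses \<open>b\<close> for none or for one of the colors of vertex 2, the
  walk is strong or weak and at least two or one pairs close up; from two such colors on nothing has
  to be shown.\<close>

lemma N_add_K_ge_2:
  assumes "h 2 = 3" "h (- 1) = 3" "\<And>j. 2 < j \<Longrightarrow> j < int n - 1 \<Longrightarrow> h j \<ge> 3" "a < h 0"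
  shows "N a b + K a b \<ge> 2"
proof -
  have "N a b \<ge> 2" if "K a b = 0"
    using N_strong_3[OF assms(3), of a b] that assms(1,2,4) by simp
  moreover have "N a b \<ge> 1" if "K a b \<le> 1"
    using N_weak_3[OF assms(3), of a b] that assms(1,2,4) by simp
  ultimately show ?thesis by linarith
qed

text \<open>Double counting over \<open>a\<close> and \<open>b\<close> gives
  \<open>6 * h 0 \<le> 9 + 3 * h 0\<close>, where 9 bounds the closing pairs and
  \<open>3 * h 0\<close> the guesses of vertex 1.\<close>

lemma all_3_but_one:
  assumes "h 1 = 3" "h 2 = 3" "h (- 1) = 3" "\<And>j. 2 < j \<Longrightarrow> j < int n - 1 \<Longrightarrow> h j \<ge> 3"
  shows "h 0 \<le> 3"
proof -
  have "6 * h 0 = (\<Sum>a<h 0. \<Sum>b<3::nat. 2)" by simp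
  also have "\<dots> \<le> (\<Sum>a<h 0. \<Sum>b<3. N a b + K a b)"
    using N_add_K_ge_2[OF assms(2,3,4)] by (intro sum_mono) auto
  also have "\<dots> = (\<Sum>a<h 0. \<Sum>b<3. N a b) + (\<Sum>a<h 0. \<Sum>b<3. K a b)"
    by (simp only: sum.distrib)
  also have "(\<Sum>a<h 0. \<Sum>b<3. N a b) = (\<Sum>b<3. \<Sum>a<h 0. N a b)" by (rule sum.swap)
  also have "\<dots> \<le> (\<Sum>b<3::nat. 3)"
    using sum_N_le assms(1,3) by (intro sum_mono) auto
  also have "(\<Sum>a<h 0. \<Sum>b<3. K a b) \<le> (\<Sum>a<h 0. 3)"
    using sum_K_le[of _ 3] assms(2) by (intro sum_mono) auto
  finally show ?thesis by simp
qed

text \<open>If \<open>K 0 b + K 1 b \<le> 1\<close>, one color of vertex 0 has at least 3 closing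
  pairs and the other at least 2, too many for the 4 colors at -1. So the four colors
  \<open>b\<close> use up 8 guesses of vertex 1, which has only 6 views.\<close>

lemma no_4_2_4:
  assumes "h 0 = 2" "h 1 = 4" "h 2 = 3" "h (- 1) = 4" "\<And>j. 2 < j \<Longrightarrow> j < int n - 1 \<Longrightarrow> h j \<ge> 3"
  shows False
proof -
  have "K 0 b + K 1 b \<ge> 2" if "b < 4" for b
  proof (rule ccontr)
    assume *: "\<not> ?thesis"
    have "N 0 b + N 1 b \<le> 4"
      using sum_N_le[of b] that assms by (simp add: sum_lessThan_2)
    moreover have "N a b \<ge> 2" if "K a b \<le> 1" "a < 2" for a
      using N_weak_3[OF assms(5), of a b] that assms by simp
    note weak = this
    moreover have strong: "N a b \<ge> 3" if "K a b = 0" "a < 2" for a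
      using N_strong_3[OF assms(5), of a b] that assms by simp
    ultimately show False using * weak[of 0] weak[of 1] strong[of 0] strong[of 1] by linarith
  qed
  from this[of 0] this[of 1] this[of 2] this[of 3] show False
    using sum_K_le[of 0 4] sum_K_le[of 1 4] assms by (simp add: sum_lessThan_4)
qed

text \<open>The same conflict: now each of the three colors \<open>b\<close> takes 3 guesses of
  vertex 1, in total 9, and there are 8 views.\<close>

lemma no_4_2_3_4:
  assumes "h 0 = 2" "h 1 = 3" "h 2 = 4" "h (- 1) = 4" "\<And>j. 2 < j \<Longrightarrow> j < int n - 1 \<Longrightarrow> h j \<ge> 3"
  shows False
proof -
  have "K 0 b + K 1 b \<ge> 3" if "b < 3" for b
  proof (rule ccontr)
    assume *: "\<not> ?thesis"
    have "N 0 b + N 1 b \<le> 4"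
      using sum_N_le[of b] that assms by (simp add: sum_lessThan_2)
    moreover have "N a b \<ge> 2" if "K a b \<le> 2" "a < 2" for a
      using N_weak_3[OF assms(5), of a b] that assms by simp
    note weak = this
    moreover have strong: "N a b \<ge> 3" if "K a b \<le> 1" "a < 2" for a
      using N_strong_3[OF assms(5), of a b] that assms by simp
    ultimately show False using * weak[of 0] weak[of 1] strong[of 0] strong[of 1] by linarith
  qed
  from this[of 0] this[of 1] this[of 2] show False
    using sum_K_le[of 0 3] sum_K_le[of 1 3] assms by (simp add: sum_lessThan_3)
qed

definition flag :: "int \<Rightarrow> bool" where
  "flag k \<longleftrightarrow> (\<exists>m. 2 \<le> m \<and> m \<le> k \<and> h m \<ge> 5 \<and> (\<forall>j. m < j \<and> j \<le> k \<longrightarrow> h j \<ge> 3))"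

text \<open>A two-state automaton: a 5 leads to the strong state, a 2 to the weak one, 3 and 4 keep
  the state, and \<open>flag\<close> says that a 5 was the last to act. By \<open>sep\<close> every
  2 is met in the strong state, so the weak guarantee survives it.\<close>

lemma weak_strong_run:
  assumes init: "weak h f a b 2" "h 2 \<ge> 5 \<Longrightarrow> strong h f a b 2"
    and ge2: "\<And>k. h k \<ge> 2" and sep: "\<And>k. 3 \<le> k \<Longrightarrow> k \<le> int n \<Longrightarrow> h k = 2 \<Longrightarrow> flag (k - 1)"
    and "2 \<le> k" "k \<le> int n"
  shows "weak h f a b k \<and> (flag k \<longrightarrow> strong h f a b k)"
  using assms(5,6)
proof (induction k rule: int_ge_induct)
  case base
  have "flag 2 \<Longrightarrow> h 2 \<ge> 5" unfolding flag_def by force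
  then show ?case using init by blast
next
  case (step k)
  then have IH: "weak h f a b k" "flag k \<Longrightarrow> strong h f a b k" by auto
  consider "h (k + 1) = 2" | "3 \<le> h (k + 1)" "h (k + 1) < 5" | "5 \<le> h (k + 1)"
    using ge2[of "k + 1"] by linarith
  then show ?case
  proof cases
    case 1
    then have "strong h f a b k" using sep[of "k + 1"] IH step by simp
    moreover have "\<not> flag (k + 1)"
    proof
      assume "flag (k + 1)"
      then obtain m where m: "m \<le> k + 1" "h m \<ge> 5" "\<forall>j. m < j \<and> j \<le> k + 1 \<longrightarrow> h j \<ge> 3"
        unfolding flag_def by blast
      show False
      proof (cases "m = k + 1")
        case True
        then show ?thesis using m(2) 1 by simp
      next
        case False
        then have "h (k + 1) \<ge> 3" using m(1,3) by simp
        then show ?thesis using 1 by simp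
      qed
    qed
    ultimately show ?thesis using strong_step_weak 1 by simp
  next
    case 2
    have "flag k" if fl: "flag (k + 1)"
    proof -
      obtain m where m: "2 \<le> m" "m \<le> k + 1" "h m \<ge> 5" "\<forall>j. m < j \<and> j \<le> k + 1 \<longrightarrow> h j \<ge> 3"
        using fl unfolding flag_def by blast
      then have "m \<noteq> k + 1" using 2 by auto
      then show ?thesis using m unfolding flag_def by (intro exI[of _ m]) auto
    qed
    then show ?thesis using IH 2 weak_step[of h f a b k] strong_step[of h f a b k] by blast
  next
    case 3
    then show ?thesis using weak_step[OF IH(1)] weak_step_strong[OF IH(1)] by simp
  qed
qed

text \<open>Either the hatness at -1 is 5 and the weak guarantee loses two colors, or the strong one
  still holds and loses one color out of at least 3.\<close>

lemma majority:
  assumes init: "weak h f a b 2" "h 2 \<ge> 5 \<Longrightarrow> strong h f a b 2"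
    and vals: "\<And>k. h k \<in> {2, 3, 5}" and sep: "\<And>k. 3 \<le> k \<Longrightarrow> k \<le> int n \<Longrightarrow> h k = 2 \<Longrightarrow> flag (k - 1)"
    and h0: "h 0 = 2" and a: "a < 2"
  shows "h (- 1) < 2 * N a b"
proof -
  have ge2: "h k \<ge> 2" for k using vals[of k] by auto
  have "weak h f a b (int n - 2) \<and> (flag (int n - 2) \<longrightarrow> strong h f a b (int n - 2))"
  proof (rule weak_strong_run[OF init ge2 sep])
    show "2 \<le> int n - 2" "int n - 2 \<le> int n" using n by simp_all
  qed
  then have run: "weak h f a b (int n - 2)" "flag (int n - 2) \<Longrightarrow> strong h f a b (int n - 2)"
    by blast+
  have "h (int n) = 2" using h_per[of 0] h0 by simp
  then have "flag (int n - 1)" using sep[of "int n"] n by simp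
  then obtain m where m: "2 \<le> m" "m \<le> int n - 1" "h m \<ge> 5" "\<forall>j. m < j \<and> j \<le> int n - 1 \<longrightarrow> h j \<ge> 3"
    unfolding flag_def by blast
  show ?thesis
  proof (cases "m = int n - 1")
    case True
    then have "h (- 1) = 5" using m(3) vals[of m] h_last by auto
    then show ?thesis using N_weak[OF run(1)] a h0 by simp
  next
    case False
    then have "h (int n - 1) \<ge> 3" using m by simp
    moreover have "flag (int n - 2)"
      unfolding flag_def using m False by (intro exI[of _ m]) auto
    ultimately show ?thesis using N_strong[OF run(2)] a h0 h_last by simp
  qed
qed

text \<open>Majorities for both colors of vertex 0 would overlap, yet the closing sets are disjoint.
  So for one of them fewer than 2 colors of vertex 2, or fewer than 3 if its hatness is 5, let
  vertex 1 be wrong.\<close>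

lemma not_both_majority:
  assumes vals: "\<And>k. h k \<in> {2, 3, 5}" and sep: "\<And>k. 3 \<le> k \<Longrightarrow> k \<le> int n \<Longrightarrow> h k = 2 \<Longrightarrow> flag (k - 1)"
    and h0: "h 0 = 2" and b: "b < h 1"
  shows "h 2 < K 0 b + (if h 2 = 5 then 3 else 2) \<or> h 2 < K 1 b + (if h 2 = 5 then 3 else 2)"
proof (rule ccontr)
  assume *: "\<not> ?thesis"
  have "h (- 1) < 2 * N a b" if "a < 2" for a
  proof (rule majority[OF _ _ vals sep h0 that])
    have K: "K a b + (if h 2 = 5 then 3 else 2) \<le> h 2"
      using * that by (cases "a = 0") (auto simp: not_less less_2_cases_iff)
    show "weak h f a b 2" using K by (intro weak_2) (auto split: if_splits)
    show "strong h f a b 2" if "h 2 \<ge> 5" using K vals[of 2] that by (intro strong_2) auto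
  qed
  from this[of 0] this[of 1] show False
    using sum_N_le[OF b] h0 by (simp add: sum_lessThan_2)
qed

text \<open>The case \<open>j = i + n\<close> is included, so a lone 2 also requires a 5 somewhere
  on the cycle.\<close>

definition separated :: bool where
  "separated \<longleftrightarrow> (\<forall>i j. i < j \<longrightarrow> j \<le> i + int n \<longrightarrow> h i = 2 \<longrightarrow> h j = 2 \<longrightarrow> (\<exists>m. i < m \<and> m < j \<and> h m = 5))"

text \<open>Each of three colors \<open>b\<close> needs an \<open>a\<close> for which vertex 1
  guesses \<open>b\<close> on more than half of the colors of vertex 2. One \<open>a\<close> can
  serve only one \<open>b\<close>, and there are only two values of \<open>a\<close>.\<close>

lemma separated_2_3:
  assumes vals: "\<And>k. h k \<in> {2, 3, 5}" and h: "h 0 = 2" "h 1 = 3" and "separated"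
  shows False
proof -
  have "flag (k - 1)" if k: "3 \<le> k" "k \<le> int n" "h k = 2" for k
  proof -
    define J where "J = {j\<in>{0..k - 1}. h j = 2}"
    have J: "finite J" "0 \<in> J"
      unfolding J_def using k h by (auto intro: finite_subset[of _ "{0..k - 1}"])
    define j where "j = Max J"
    have j: "0 \<le> j" "j < k" "h j = 2" using Max_in[OF J(1)] J(2) by (auto simp: j_def J_def)
    then obtain m where m: "j < m" "m < k" "h m = 5"
      using \<open>separated\<close> k unfolding separated_def by force
    have "h l \<ge> 3" if "m < l" "l \<le> k - 1" for l
    proof -
      have "l \<notin> J" using Max_ge[OF J(1), of l] that m by (auto simp: j_def)
      then show ?thesis using that m j vals[of l] by (auto simp: J_def)
    qed
    moreover have "m \<noteq> 1" using m h by auto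
    ultimately show ?thesis unfolding flag_def using m j by (intro exI[of _ m]) auto
  qed
  then have bad: "h 2 < K 0 b + (if h 2 = 5 then 3 else 2) \<or> h 2 < K 1 b + (if h 2 = 5 then 3 else 2)"
    if "b < h 1" for b
    using not_both_majority[of b] vals h(1) that by blast
  have "h 2 \<noteq> 2"
  proof
    assume "h 2 = 2"
    then obtain m where "0 < m" "m < 2" "h m = 5"
      using \<open>separated\<close>[unfolded separated_def, rule_format, of 0 2] h n by auto
    then have "m = 1" by simp
    then show False using h \<open>h m = 5\<close> by simp
  qed
  define t :: nat where "t = (if h 2 = 5 then 3 else 2)"
  have t: "h 2 < 2 * t" "h 2 + 1 \<ge> 2 * t" using \<open>h 2 \<noteq> 2\<close> vals[of 2] by (auto simp: t_def)
  have "K 0 b \<ge> t \<or> K 1 b \<ge> t" if "b < 3" for b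
    using bad[of b] that h t unfolding t_def[symmetric] by linarith
  from this[of 0] this[of 1] this[of 2] have "t \<le> K 0 0 \<or> t \<le> K 1 0"
    "t \<le> K 0 1 \<or> t \<le> K 1 1" "t \<le> K 0 2 \<or> t \<le> K 1 2" by auto
  moreover have "K 0 0 + K 0 1 + K 0 2 < 2 * t" "K 1 0 + K 1 1 + K 1 2 < 2 * t"
    using sum_K_le[of 0 3] sum_K_le[of 1 3] t by (simp_all add: sum_lessThan_3)
  ultimately show False by linarith
qed

text \<open>Each of five colors \<open>b\<close> takes at least \<open>t\<close> guesses of vertex
  1, where \<open>t\<close> is 1, 2, 3 for \<open>h 2\<close> equal to 2, 3, 5; vertex 1 has only
  \<open>2 * h 2\<close> views.\<close>

lemma separated_5_2_5:
  assumes vals: "\<And>k. h k \<in> {2, 3, 5}" and h: "h 0 = 2" "h 1 = 5"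
    and nbr: "\<And>k. h k = 2 \<Longrightarrow> h (k - 1) = 5"
  shows False
proof -
  have "flag (k - 1)" if k: "3 \<le> k" "k \<le> int n" "h k = 2" for k
    unfolding flag_def using nbr[OF k(3)] k by (intro exI[of _ "k - 1"]) auto
  then have bad: "h 2 < K 0 b + (if h 2 = 5 then 3 else 2) \<or> h 2 < K 1 b + (if h 2 = 5 then 3 else 2)"
    if "b < h 1" for b
    using not_both_majority[of b] vals h(1) that by blast
  define t where "t = h 2 + 1 - (if h 2 = 5 then 3 else 2)"
  have t: "2 * h 2 < 5 * t" using vals[of 2] by (auto simp: t_def)
  have "K 0 b + K 1 b \<ge> t" if "b < 5" for b
    using bad[of b] that h unfolding t_def by linarith
  from this[of 0] this[of 1] this[of 2] this[of 3] this[of 4] show False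
    using sum_K_le[of 0 5] sum_K_le[of 1 5] t by (simp add: sum_lessThan_5)
qed

end

text \<open>In each view a vertex is right on at most one of its colors, so vertex 0 covers at most
  \<open>h 1 * h 2\<close> colorings, and similarly the others. For the triangle this union bound is
  already sharp.\<close>

lemma cyc_winning_triangle_imp:
  assumes "cyc_winning 3 h" and per: "\<And>i. h (i + 3) = h i"
  shows "h 0 * h 1 * h 2 \<le> h 1 * h 2 + h 0 * h 2 + h 0 * h 1"
proof -
  obtain f where f: "cyc_strategy 3 h f" using assms(1) by (auto simp: cyc_winning_def)
  define A0 where "A0 = (\<lambda>(q, r). (f 0 r q, q, r)) ` ({..<h 1} \<times> {..<h 2})"
  define A1 where "A1 = (\<lambda>(p, r). (p, f 1 p r, r)) ` ({..<h 0} \<times> {..<h 2})"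
  define A2 where "A2 = (\<lambda>(p, q). (p, q, f 2 q p)) ` ({..<h 0} \<times> {..<h 1})"
  have "{..<h 0} \<times> {..<h 1} \<times> {..<h 2} \<subseteq> A0 \<union> A1 \<union> A2"
  proof
    fix z assume "z \<in> {..<h 0} \<times> {..<h 1} \<times> {..<h 2}"
    then obtain p q r where z: "z = (p, q, r)" "p < h 0" "q < h 1" "r < h 2" by auto
    define x where "x i = (if i mod 3 = 0 then p else if i mod 3 = 1 then q else r)" for i :: int
    have "cyc_coloring 3 h x"
      unfolding cyc_coloring_def
    proof (intro conjI allI)
      fix i :: int
      have "h (i mod 3) = h i" by (rule periodic_mod_eq[of h 3]) (simp_all add: per)
      moreover have "i mod 3 = 0 \<or> i mod 3 = 1 \<or> i mod 3 = 2" by presburger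
      ultimately show "x i < h i" using z by (auto simp: x_def)
    qed (simp add: x_def)
    then obtain i where i: "f i (x (i - 1)) (x (i + 1)) = x i"
      using f unfolding cyc_strategy_def by blast
    have fi: "f (i mod 3) = f i" by (rule cyc_strategy_mod_eq[OF f]) simp
    have "i mod 3 = 0 \<or> i mod 3 = 1 \<or> i mod 3 = 2" by presburger
    then consider "i mod 3 = 0" | "i mod 3 = 1" | "i mod 3 = 2" by blast
    then show "z \<in> A0 \<union> A1 \<union> A2"
    proof cases
      case 1
      then have "(i - 1) mod 3 = 2" "(i + 1) mod 3 = 1" by presburger+
      then have "f 0 r q = p" using i fi 1 by (simp add: x_def)
      then show ?thesis using z by (force simp: A0_def)
    next
      case 2
      then have "(i - 1) mod 3 = 0" "(i + 1) mod 3 = 2" by presburger+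
      then have "f 1 p r = q" using i fi 2 by (simp add: x_def)
      then show ?thesis using z by (force simp: A1_def)
    next
      case 3
      then have "(i - 1) mod 3 = 1" "(i + 1) mod 3 = 0" by presburger+
      then have "f 2 q p = r" using i fi 3 by (simp add: x_def)
      then show ?thesis using z by (force simp: A2_def)
    qed
  qed
  then have "card ({..<h 0} \<times> {..<h 1} \<times> {..<h 2}) \<le> card (A0 \<union> A1 \<union> A2)"
    by (intro card_mono) (simp_all add: A0_def A1_def A2_def)
  also have "\<dots> \<le> card A0 + card A1 + card A2"
    using card_Un_le[of "A0 \<union> A1" A2] card_Un_le[of A0 A1] by linarith
  also have "\<dots> \<le> h 1 * h 2 + h 0 * h 2 + h 0 * h 1"
  proof (intro add_mono)
    have "card A0 \<le> card ({..<h 1} \<times> {..<h 2})" unfolding A0_def by (intro card_image_le) simp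
    then show "card A0 \<le> h 1 * h 2" by (simp add: card_cartesian_product)
    have "card A1 \<le> card ({..<h 0} \<times> {..<h 2})" unfolding A1_def by (intro card_image_le) simp
    then show "card A1 \<le> h 0 * h 2" by (simp add: card_cartesian_product)
    have "card A2 \<le> card ({..<h 0} \<times> {..<h 1})" unfolding A2_def by (intro card_image_le) simp
    then show "card A2 \<le> h 0 * h 1" by (simp add: card_cartesian_product)
  qed
  finally show ?thesis by (simp add: card_cartesian_product mult.assoc)
qed

section \<open>Rigidity of strategies with three colors\<close>

definition cnt :: "(nat \<Rightarrow> nat) \<Rightarrow> nat \<Rightarrow> nat" where
  "cnt g b = (if g 0 = b then 1 else 0) + (if g 1 = b then 1 else 0) + (if g 2 = b then 1 else 0)"

lemma all_less_3: "(\<forall>c<3. Q c) \<longleftrightarrow> Q 0 \<and> Q 1 \<and> Q (2::nat)"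
  unfolding less_3_cases by blast

lemma ex_less_3: "(\<exists>c<3. Q c) \<longleftrightarrow> Q 0 \<or> Q 1 \<or> Q (2::nat)"
  unfolding less_3_cases by blast

lemma card_eq_cnt: "card {c. c < 3 \<and> g c = b} = cnt g b"
proof -
  have "{c. c < 3 \<and> g c = b} =
    (if g 0 = b then {0} else {}) \<union> (if g 1 = b then {1} else {}) \<union> (if g 2 = b then {2} else {})"
  proof (rule set_eqI)
    fix c :: nat
    show "c \<in> {c. c < 3 \<and> g c = b} \<longleftrightarrow> c \<in> (if g 0 = b then {0} else {}) \<union>
      (if g 1 = b then {1} else {}) \<union> (if g 2 = b then {2} else {})"
      by (cases "c = 0"; cases "c = 1"; cases "c = 2") auto
  qed
  then show ?thesis by (simp add: cnt_def)
qed

lemma sum_cnt: "\<forall>c<3. g c < 3 \<Longrightarrow> cnt g 0 + cnt g 1 + cnt g 2 = 3"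
  unfolding all_less_3 unfolding less_3_cases cnt_def by (elim conjE disjE) simp_all

lemma cnt_0_iff: "cnt g b = 0 \<longleftrightarrow> (\<forall>c<3. g c \<noteq> b)"
  unfolding all_less_3 by (auto simp: cnt_def)

lemma cnt_1E:
  assumes "cnt g b = 1"
  obtains x where "x < 3" "g x = b" "\<And>c. c < 3 \<Longrightarrow> g c = b \<Longrightarrow> c = x"
proof -
  have "\<exists>x<3. g x = b \<and> (\<forall>c<3. g c = b \<longrightarrow> c = x)"
    using assms unfolding ex_less_3 all_less_3
    by (cases "g 0 = b"; cases "g 1 = b"; cases "g 2 = b") (simp_all add: cnt_def)
  then show thesis using that by blast
qed

lemma cnt_1_ex: "cnt g b = 1 \<Longrightarrow> \<exists>x<3. g x = b"
  by (metis cnt_1E)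

lemma cnt_ge_2: "c < 3 \<Longrightarrow> c' < 3 \<Longrightarrow> c \<noteq> c' \<Longrightarrow> g c = b \<Longrightarrow> g c' = b \<Longrightarrow> cnt g b \<ge> 2"
  unfolding less_3_cases by (elim disjE) (simp_all add: cnt_def)

lemma cnt_eq_3: "\<forall>c<3. g c = b \<Longrightarrow> cnt g b = 3"
  unfolding all_less_3 by (simp add: cnt_def)

lemma cnt_onto:
  assumes "\<And>y. y < 3 \<Longrightarrow> \<exists>d<3. g d = y" "b < 3"
  shows "cnt g b = 1"
proof -
  have "g 0 = 0 \<or> g 1 = 0 \<or> g 2 = 0" "g 0 = 1 \<or> g 1 = 1 \<or> g 2 = 1" "g 0 = 2 \<or> g 1 = 2 \<or> g 2 = 2"
    using assms(1)[of 0] assms(1)[of 1] assms(1)[of 2] unfolding ex_less_3 by auto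
  then show ?thesis using assms(2) unfolding less_3_cases cnt_def by auto
qed

section \<open>The all-3 game: equality at every vertex\<close>

locale cyc_game_3 = cyc_game n h f for n h f +
  assumes h3: "\<And>i. h i = 3" and n5: "n \<ge> 5"
begin

lemma K_eq: "K a b = cnt (f 1 a) b"
  unfolding K_def h3 by (rule card_eq_cnt)

lemma N_le: "a < 3 \<Longrightarrow> b < 3 \<Longrightarrow> N a b \<le> cnt (\<lambda>d. f 0 d b) a"
  unfolding N_def card_eq_cnt[symmetric] using walk_closed[of a b] h3[of 0] h3[of 1] h3[of "- 1"]
  by (intro card_mono) auto

text \<open>Over the nine pairs the row counts and the column counts both total 9, together nine
  times the lower bound 2 for \<open>N a b + cnt (f 1 a) b\<close>. As \<open>N\<close> is at most
  the column count, there is no slack.\<close>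

lemma edge_count:
  assumes val: "\<And>i a c. a < 3 \<Longrightarrow> c < 3 \<Longrightarrow> f i a c < 3" and a: "a < 3" and b: "b < 3"
  shows "cnt (\<lambda>d. f 0 d b) a + cnt (f 1 a) b = 2" and "N a b + cnt (f 1 a) b = 2"
proof -
  let ?L = "\<lambda>a b. cnt (\<lambda>d. f 0 d b) a" and ?R = "\<lambda>a b. cnt (f 1 a) b"
  have ge: "N a b + ?R a b \<ge> 2" if "a < 3" for a b
    using N_add_K_ge_2[of a b] that h3 K_eq by simp
  have le: "N a b \<le> ?L a b" if "a < 3" "b < 3" for a b
    using N_le that by blast
  have L: "?L 0 b + ?L 1 b + ?L 2 b = 3" if "b < 3" for b
    using val that by (intro sum_cnt) auto
  have R: "?R a 0 + ?R a 1 + ?R a 2 = 3" if "a < 3" for a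
    using val that by (intro sum_cnt) auto
  have G: "N 0 0 + ?R 0 0 \<ge> 2" "N 0 1 + ?R 0 1 \<ge> 2" "N 0 2 + ?R 0 2 \<ge> 2"
    "N 1 0 + ?R 1 0 \<ge> 2" "N 1 1 + ?R 1 1 \<ge> 2" "N 1 2 + ?R 1 2 \<ge> 2"
    "N 2 0 + ?R 2 0 \<ge> 2" "N 2 1 + ?R 2 1 \<ge> 2" "N 2 2 + ?R 2 2 \<ge> 2"
    by (rule ge; simp)+
  have E: "N 0 0 \<le> ?L 0 0" "N 0 1 \<le> ?L 0 1" "N 0 2 \<le> ?L 0 2"
    "N 1 0 \<le> ?L 1 0" "N 1 1 \<le> ?L 1 1" "N 1 2 \<le> ?L 1 2"
    "N 2 0 \<le> ?L 2 0" "N 2 1 \<le> ?L 2 1" "N 2 2 \<le> ?L 2 2"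
    by (rule le; simp)+
  have S: "?L 0 0 + ?L 1 0 + ?L 2 0 = 3" "?L 0 1 + ?L 1 1 + ?L 2 1 = 3"
    "?L 0 2 + ?L 1 2 + ?L 2 2 = 3"
    "?R 0 0 + ?R 0 1 + ?R 0 2 = 3" "?R 1 0 + ?R 1 1 + ?R 1 2 = 3" "?R 2 0 + ?R 2 1 + ?R 2 2 = 3"
    by (rule L R; simp)+
  show "?L a b + ?R a b = 2" "N a b + ?R a b = 2"
    using a b unfolding less_3_cases by (elim disjE; hypsubst; use G E S in linarith)+
qed

text \<open>A color followed by all three makes the walk strong one position later. At
  \<open>k = n - 2\<close> the next color is the closing \<open>a\<close>, which excludes only the
  guess \<open>f (k + 1) u a\<close>.\<close>

lemma full_imp_N_ge_2:
  assumes "a < 3" "0 \<le> k" "k \<le> int n - 2" and full: "\<And>c. c < 3 \<Longrightarrow> W a b k u c"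
  shows "N a b \<ge> 2"
proof (cases "k = int n - 2")
  case True
  have "{..<3} - {f (k + 1) u a} \<subseteq> {v. v < h (- 1) \<and> W a b (int n - 1) v a}"
  proof
    fix v assume v: "v \<in> {..<3} - {f (k + 1) u a}"
    then have "W a b (k + 1) v a"
      using walk_step[OF full, of v a] assms(1) h3 by auto
    then show "v \<in> {v. v < h (- 1) \<and> W a b (int n - 1) v a}"
      using True v h3 by simp
  qed
  then have "card ({..<3} - {f (k + 1) u a}) \<le> N a b" unfolding N_def by (intro card_mono) auto
  moreover have "card {..<3::nat} - card {f (k + 1) u a} \<le> card ({..<3} - {f (k + 1) u a})"
    by (rule diff_card_le_card_Diff) simp
  ultimately show ?thesis by simp
next
  case False
  have "strong h f a b (k + 1)"
    using strongI[OF full full full, of 0 1 2] by simp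
  then have "strong h f a b (int n - 2)"
    by (rule strong_steps[rotated]) (use False assms h3 in auto)
  then show ?thesis using N_strong assms(1) h3 by force
qed

text \<open>A count of 1 leaves a single closing pair, so no color on the walk may be followed by
  all three. For color \<open>y\<close> of vertex 2 this gives the first claim, for color
  \<open>d0\<close> of vertex 3 the second, where \<open>n \<ge> 5\<close> is used.\<close>

lemma unique_row_value:
  assumes val: "\<And>i a c. a < 3 \<Longrightarrow> c < 3 \<Longrightarrow> f i a c < 3" and ab: "a < 3" "b < 3"
    and c1: "cnt (f 1 a) b = 1" and x: "x < 3" "f 1 a x = b" and y: "y < 3" "y \<noteq> x"
  shows "\<exists>d<3. f 2 b d = y"
    and "y' < 3 \<Longrightarrow> y' \<noteq> x \<Longrightarrow> d0 < 3 \<Longrightarrow> f 2 b d0 = x \<Longrightarrow> y' \<noteq> y \<Longrightarrow>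
      \<exists>e<3. f 3 y e = d0 \<and> f 3 y' e = d0"
proof -
  have N1: "\<not> N a b \<ge> 2" using edge_count(2)[OF val ab] c1 by simp
  have start: "W a b 1 b z" if "z < 3" "z \<noteq> x" for z
  proof (rule walk_1)
    show "f 1 a z \<noteq> b" using that c1 x cnt_ge_2[of z x "f 1 a" b] by auto
  qed (use that h3 in simp)
  have second: "W a b 2 z d" if "z < 3" "z \<noteq> x" "d < 3" "f 2 b d \<noteq> z" for z d
    using walk_step[OF start[OF that(1,2)], of d] that h3 by simp
  show "\<exists>d<3. f 2 b d = y"
  proof (rule ccontr)
    assume "\<not> ?thesis"
    then have "W a b 2 y d" if "d < 3" for d using second y that by auto
    then have "N a b \<ge> 2" using full_imp_N_ge_2[of a 2 b y] ab n5 by simp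
    then show False using N1 by blast
  qed
  show "\<exists>e<3. f 3 y e = d0 \<and> f 3 y' e = d0"
    if y': "y' < 3" "y' \<noteq> x" and d0: "d0 < 3" "f 2 b d0 = x" and "y' \<noteq> y"
  proof (rule ccontr)
    assume neg: "\<not> ?thesis"
    have "W a b 3 d0 e" if e: "e < 3" for e
    proof -
      have "W a b 2 y d0" "W a b 2 y' d0" using second y y' d0 by auto
      then have "W a b (2 + 1) d0 e \<or> f (2 + 1) y e = d0" "W a b (2 + 1) d0 e \<or> f (2 + 1) y' e = d0"
        using walk_step'[of h f a b 2 _ d0 e] e h3 by auto
      then show ?thesis using neg e by auto
    qed
    then have "N a b \<ge> 2" using full_imp_N_ge_2[of a 3 b d0] ab n5 by simp
    then show False using N1 by blast
  qed
qed

end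

text \<open>Every vertex can play vertex 0, so the facts found at vertices 0 to 3 hold at all
  positions. This locale keeps only them and forgets game and length.\<close>

locale rigid =
  fixes F :: "int \<Rightarrow> nat \<Rightarrow> nat \<Rightarrow> nat"
  assumes val: "a < 3 \<Longrightarrow> c < 3 \<Longrightarrow> F i a c < 3"
    and edge: "a < 3 \<Longrightarrow> b < 3 \<Longrightarrow> cnt (\<lambda>d. F i d b) a + cnt (F (i + 1) a) b = 2"
    and unique_hit: "a < 3 \<Longrightarrow> b < 3 \<Longrightarrow> cnt (F i a) b = 1 \<Longrightarrow> x < 3 \<Longrightarrow> F i a x = b \<Longrightarrow>
      y < 3 \<Longrightarrow> y \<noteq> x \<Longrightarrow> \<exists>d<3. F (i + 1) b d = y"
    and unique_double: "a < 3 \<Longrightarrow> b < 3 \<Longrightarrow> cnt (F i a) b = 1 \<Longrightarrow> x < 3 \<Longrightarrow> F i a x = b \<Longrightarrow>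
      y < 3 \<Longrightarrow> y \<noteq> x \<Longrightarrow> y' < 3 \<Longrightarrow> y' \<noteq> x \<Longrightarrow> y' \<noteq> y \<Longrightarrow> d < 3 \<Longrightarrow> F (i + 1) b d = x \<Longrightarrow>
      \<exists>e<3. F (i + 2) y e = d \<and> F (i + 2) y' e = d"
begin

abbreviation R :: "int \<Rightarrow> nat \<Rightarrow> nat \<Rightarrow> nat" where "R i a b \<equiv> cnt (F i a) b"
abbreviation L :: "int \<Rightarrow> nat \<Rightarrow> nat \<Rightarrow> nat" where "L i b c \<equiv> cnt (\<lambda>d. F i d c) b"

lemma sum_R: "a < 3 \<Longrightarrow> R i a 0 + R i a 1 + R i a 2 = 3"
  using val by (intro sum_cnt) auto

lemma sum_L: "c < 3 \<Longrightarrow> L i 0 c + L i 1 c + L i 2 c = 3"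
  using val by (intro sum_cnt) auto

lemma edge': "a < 3 \<Longrightarrow> b < 3 \<Longrightarrow> L (i - 1) a b + R i a b = 2"
  using edge[of a b "i - 1"] by simp

text \<open>By \<open>edge'\<close> each entry is 2 minus an \<open>L\<close> count, and these
  counts add up to 3. So \<open>R i\<close> is a 3 by 3 matrix with entries at most 2 and all row
  and column sums 3.\<close>

lemma sum_R_col:
  assumes "b < 3"
  shows "R i 0 b + R i 1 b + R i 2 b = 3"
  using edge'[of 0 b i] edge'[of 1 b i] edge'[of 2 b i] sum_L[of b "i - 1"] assms by simp

lemma R_le_2: "a < 3 \<Longrightarrow> b < 3 \<Longrightarrow> R i a b \<le> 2"
  using edge'[of a b i] by simp

text \<open>Another row, with sum 3 and entries at most 2, contains a 1. Its column then has two
  ones, and the column sum supplies the third.\<close>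

lemma ones_row_imp_ones_col:
  assumes a: "a < 3" and ones: "\<forall>b<3. R i a b = 1"
  shows "\<exists>b<3. \<forall>a'<3. R i a' b = 1"
proof -
  define a1 :: nat where "a1 = (if a = 0 then 1 else 0)"
  have a1: "a1 < 3" by (simp add: a1_def)
  have "x = 1 \<or> y = 1 \<or> z = 1" if "x + y + z = 3" "x \<le> 2" "y \<le> 2" "z \<le> 2" for x y z :: nat
    using that by presburger
  from this[OF sum_R[OF a1, of i] R_le_2[OF a1] R_le_2[OF a1] R_le_2[OF a1]]
  have "\<exists>b<3. R i a1 b = 1" unfolding ex_less_3 by simp
  then obtain b where b: "b < 3" "R i a1 b = 1" by blast
  have "R i a b = 1" using ones b by blast
  then have "\<forall>a'<3. R i a' b = 1"
    using sum_R_col[OF b(1), of i] b(2) a unfolding all_less_3 less_3_cases a1_def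
    by (auto split: if_splits)
  then show ?thesis using b(1) by blast
qed

text \<open>In a column \<open>b\<close> of ones, two rows hit \<open>b\<close> at different places,
  since otherwise an \<open>L\<close> count would be 3. Applied to both places,
  \<open>unique_hit\<close> makes \<open>F (i + 1) b\<close> onto.\<close>

lemma ones_row_step:
  assumes a: "a < 3" and ones: "\<forall>b<3. R i a b = 1"
  obtains b where "b < 3" "\<forall>a'<3. R i a' b = 1" "\<forall>c<3. R (i + 1) b c = 1" "\<forall>c<3. L i b c = 1"
proof -
  obtain b where b: "b < 3" "\<And>a'. a' < 3 \<Longrightarrow> R i a' b = 1"
    using ones_row_imp_ones_col[OF assms] by blast
  obtain x where x: "x < 3" "F i 0 x = b" using cnt_1_ex[OF b(2)[of 0]] by auto
  have "\<exists>a'<3. F i a' x \<noteq> b"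
  proof (rule ccontr)
    assume "\<not> ?thesis"
    then have "L i b x = 3" by (intro cnt_eq_3) auto
    then show False using edge[OF b(1) x(1), of i] by simp
  qed
  then obtain a' where a': "a' < 3" "F i a' x \<noteq> b" by blast
  obtain x' where x': "x' < 3" "F i a' x' = b" using cnt_1_ex[OF b(2)[OF a'(1)]] by auto
  have "x' \<noteq> x" using a' x' by auto
  have "\<exists>d<3. F (i + 1) b d = y" if "y < 3" for y
    using unique_hit[OF _ b(1) b(2) x, of y] unique_hit[OF _ b(1) b(2) x', of y] a' that \<open>x' \<noteq> x\<close>
    by (cases "y = x") auto
  then have ones': "R (i + 1) b c = 1" if "c < 3" for c using cnt_onto that by blast
  have "L i b c = 1" if "c < 3" for c using edge[OF b(1) that, of i] ones'[OF that] by simp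
  then show thesis using that b ones' by blast
qed

text \<open>
  An all-ones row propagates to the right. Three steps later it makes some column of \<open>F (i + 2)\<close>
  bijective, whereas \<open>unique_double\<close> gives each of the three columns a repeated value.
\<close>

lemma no_ones_row:
  assumes a: "a < 3"
  shows "\<not> (\<forall>b<3. R i a b = 1)"
proof
  assume "\<forall>b<3. R i a b = 1"
  then obtain b where b: "b < 3" "\<forall>a'<3. R i a' b = 1" "\<forall>c<3. R (i + 1) b c = 1" "\<forall>c<3. L i b c = 1"
    by (rule ones_row_step[OF a])
  \<comment> \<open>With \<open>x\<close> the guess \<open>F (i + 1) b d\<close> and
    \<open>a'\<close> a color for which vertex \<open>i\<close> guesses \<open>b\<close> on seeing
    \<open>x\<close>, the two colors other than \<open>x\<close> are the pair in
    \<open>unique_double\<close>.\<close>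
  have double: "\<exists>e<3. L (i + 2) d e \<ge> 2" if d: "d < 3" for d
  proof -
    define x where "x = F (i + 1) b d"
    have x: "x < 3" using val b(1) d by (simp add: x_def)
    then have "L i b x = 1" using b(4) by blast
    then obtain a' where a': "a' < 3" "F i a' x = b" using cnt_1_ex by blast
    obtain y y' where y: "y < 3" "y \<noteq> x" "y' < 3" "y' \<noteq> x" "y' \<noteq> y"
    proof (cases "x = 0")
      case True
      then show thesis using that[of 1 2] by simp
    next
      case False
      then show thesis using that[of 0 "3 - x"] x by (auto simp: less_3_cases)
    qed
    have "R i a' b = 1" using b(2) a'(1) by blast
    then obtain e where e: "e < 3" "F (i + 2) y e = d" "F (i + 2) y' e = d"
      using unique_double[OF a'(1) b(1) _ x a'(2) y d] x_def by blast
    then have "L (i + 2) d e \<ge> 2" using cnt_ge_2[of y y' "\<lambda>z. F (i + 2) z e" d] y by simp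
    then show ?thesis using e(1) by blast
  qed
  have propagate: "\<exists>b<3. \<forall>c<3. R (j + 1) b c = 1" if ex: "\<exists>a<3. \<forall>b<3. R j a b = 1" for j
  proof -
    obtain a where "a < 3" "\<forall>b<3. R j a b = 1" using ex by blast
    then obtain b where "b < 3" "\<forall>a'<3. R j a' b = 1" "\<forall>c<3. R (j + 1) b c = 1" "\<forall>c<3. L j b c = 1"
      by (rule ones_row_step)
    then show ?thesis by blast
  qed
  have "\<exists>b<3. \<forall>c<3. R (i + 1) b c = 1" using b by blast
  then obtain b2 where b2: "b2 < 3" "\<forall>c<3. R (i + 1 + 1 + 1) b2 c = 1"
    using propagate[OF propagate] by blast
  obtain e where e: "e < 3" "\<forall>a'<3. R (i + 1 + 1 + 1) a' e = 1"
    using ones_row_imp_ones_col[OF b2] by blast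
  have Le: "L (i + 2) d e = 1" if "d < 3" for d
    using edge[OF that e(1), of "i + 2"] e(2) that by (simp add: add.assoc)
  obtain e0 where e0: "e0 < 3" "L (i + 2) 0 e0 \<ge> 2" using double[of 0] by auto
  obtain e1 where e1: "e1 < 3" "L (i + 2) 1 e1 \<ge> 2" using double[of 1] by auto
  obtain e2 where e2: "e2 < 3" "L (i + 2) 2 e2 \<ge> 2" using double[of 2] by auto
  \<comment> \<open>A column of three values cannot repeat two of them, so the three repeated values
    occupy all three columns and leave none for \<open>e\<close>.\<close>
  have "e0 \<noteq> e1" "e0 \<noteq> e2" "e1 \<noteq> e2"
    using sum_L[OF e0(1), of "i + 2"] sum_L[OF e1(1), of "i + 2"] e0 e1 e2 by auto
  moreover have "e \<noteq> e0" "e \<noteq> e1" "e \<noteq> e2"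
    using Le[of 0] Le[of 1] Le[of 2] e0 e1 e2 by auto
  ultimately show False using e(1) e0(1) e1(1) e2(1) by linarith
qed

end

lemma sum_3_cases:
  fixes x y z k :: nat
  assumes "x + y + z = 3" "x \<le> 2" "y \<le> 2" "z \<le> 2" "\<not> (x = 1 \<and> y = 1 \<and> z = 1)" "k < 3"
  shows "x = k \<and> y \<noteq> k \<and> z \<noteq> k \<or> x \<noteq> k \<and> y = k \<and> z \<noteq> k \<or> x \<noteq> k \<and> y \<noteq> k \<and> z = k"
proof -
  have "x = 0 \<or> x = 1 \<or> x = 2" "y = 0 \<or> y = 1 \<or> y = 2" "z = 0 \<or> z = 1 \<or> z = 2"
    "k = 0 \<or> k = 1 \<or> k = 2"
    using assms by auto
  then show ?thesis using assms(1,5) by (elim disjE) simp_all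
qed

lemma three_distinct:
  fixes x p q r :: nat
  assumes "x < 3" "p < 3" "q < 3" "r < 3" "p \<noteq> q" "p \<noteq> r" "q \<noteq> r"
  shows "x = p \<or> x = q \<or> x = r"
  using assms by linarith

context rigid
begin

text \<open>Any other column contains a 1 as well; that row would have two ones, hence
  three.\<close>

lemma no_ones_col:
  assumes b: "b < 3"
  shows "\<not> (\<forall>a<3. R i a b = 1)"
proof
  assume ones: "\<forall>a<3. R i a b = 1"
  define b' :: nat where "b' = (if b = 0 then 1 else 0)"
  have b': "b' < 3" by (simp add: b'_def)
  have neq: "R i a b' \<noteq> 1" if a: "a < 3" for a
  proof
    assume "R i a b' = 1"
    moreover have "R i a b = 1" using ones a by blast
    ultimately have "\<forall>b<3. R i a b = 1"
      using sum_R[OF a, of i] b unfolding all_less_3 less_3_cases b'_def by (auto split: if_splits)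
    then show False using no_ones_row[OF a] by blast
  qed
  have "x + y + z \<noteq> 3" if "x \<le> 2" "y \<le> 2" "z \<le> 2" "x \<noteq> 1" "y \<noteq> 1" "z \<noteq> 1" for x y z :: nat
    using that by presburger
  then show False
    using sum_R_col[OF b', of i] neq R_le_2[OF _ b', of _ i] by (metis less_3_cases)
qed

lemma R_row_ex1:
  assumes "a < 3" "k < 3"
  shows "\<exists>!b. b < 3 \<and> R i a b = k"
proof -
  have "\<not> (R i a 0 = 1 \<and> R i a 1 = 1 \<and> R i a 2 = 1)"
    using no_ones_row[OF assms(1), of i] unfolding all_less_3 by blast
  then have "R i a 0 = k \<and> R i a 1 \<noteq> k \<and> R i a 2 \<noteq> k \<or> R i a 0 \<noteq> k \<and> R i a 1 = k \<and> R i a 2 \<noteq> k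
      \<or> R i a 0 \<noteq> k \<and> R i a 1 \<noteq> k \<and> R i a 2 = k"
    using sum_R[OF assms(1), of i] R_le_2[OF assms(1), of 0 i] R_le_2[OF assms(1), of 1 i]
      R_le_2[OF assms(1), of 2 i] assms(2) by (intro sum_3_cases) simp_all
  then show ?thesis unfolding less_3_cases by (elim disjE) (rule ex1I; force)+
qed

lemma R_col_unique:
  assumes "b < 3" "k < 3" "a < 3" "a' < 3" "R i a b = k" "R i a' b = k"
  shows "a = a'"
proof -
  have "\<not> (R i 0 b = 1 \<and> R i 1 b = 1 \<and> R i 2 b = 1)"
    using no_ones_col[OF assms(1), of i] unfolding all_less_3 by blast
  then have "R i 0 b = k \<and> R i 1 b \<noteq> k \<and> R i 2 b \<noteq> k \<or> R i 0 b \<noteq> k \<and> R i 1 b = k \<and> R i 2 b \<noteq> k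
      \<or> R i 0 b \<noteq> k \<and> R i 1 b \<noteq> k \<and> R i 2 b = k"
    using sum_R_col[OF assms(1), of i] R_le_2[OF _ assms(1), of 0 i] R_le_2[OF _ assms(1), of 1 i]
      R_le_2[OF _ assms(1), of 2 i] assms(2) by (intro sum_3_cases) simp_all
  then show ?thesis using assms(3-6) unfolding less_3_cases by metis
qed

text \<open>
  So \<open>R i\<close> is a Latin square with entries 0, 1, 2, and \<open>pos i 0\<close>, \<open>pos i 1\<close>, \<open>pos i 2\<close> are the
  three families of bijections.
\<close>

definition pos :: "int \<Rightarrow> nat \<Rightarrow> nat \<Rightarrow> nat" where
  "pos i k a = (THE b. b < 3 \<and> R i a b = k)"

lemma pos:
  assumes "a < 3" "k < 3"
  shows "pos i k a < 3" "R i a (pos i k a) = k"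
proof -
  have "pos i k a < 3 \<and> R i a (pos i k a) = k"
    unfolding pos_def by (rule theI'[OF R_row_ex1[OF assms]])
  then show "pos i k a < 3" "R i a (pos i k a) = k" by simp_all
qed

lemma pos_eqI:
  assumes "a < 3" "k < 3" "b < 3" "R i a b = k"
  shows "pos i k a = b"
proof -
  have "\<exists>!b. b < 3 \<and> R i a b = k" by (rule R_row_ex1[OF assms(1,2)])
  then show ?thesis using pos[OF assms(1,2), of i] assms(3,4) by blast
qed

lemma pos_inj: "a < 3 \<Longrightarrow> a' < 3 \<Longrightarrow> k < 3 \<Longrightarrow> pos i k a = pos i k a' \<longleftrightarrow> a = a'"
proof (rule iffI)
  assume lt: "a < 3" "a' < 3" "k < 3" and eq: "pos i k a = pos i k a'"
  show "a = a'"
    by (rule R_col_unique[OF pos(1)[OF lt(1,3), of i] lt(3,1,2) pos(2)[OF lt(1,3), of i]])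
      (use pos(2)[OF lt(2,3), of i] eq in simp)
qed simp

lemma pos_inj_k:
  assumes "a < 3" "k < 3" "k' < 3"
  shows "pos i k a = pos i k' a \<longleftrightarrow> k = k'"
proof
  assume eq: "pos i k a = pos i k' a"
  have "k = R i a (pos i k a)" by (rule pos(2)[OF assms(1,2), symmetric])
  also have "\<dots> = k'" unfolding eq by (rule pos(2)[OF assms(1,3)])
  finally show "k = k'" .
qed simp

lemma wrong_0: "a < 3 \<Longrightarrow> c < 3 \<Longrightarrow> F i a c \<noteq> pos i 0 a"
proof -
  assume "a < 3" "c < 3"
  have "R i a (pos i 0 a) = 0" by (rule pos(2)) (use \<open>a < 3\<close> in simp_all)
  then show ?thesis using \<open>c < 3\<close> unfolding cnt_0_iff by blast
qed

text \<open>\<open>unique_hit\<close> lets every color other than \<open>c\<close> occur in the row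
  of the next vertex, so \<open>c\<close> must be the color missing there.\<close>

lemma wrong_1:
  assumes "a < 3" "c < 3" "F i a c = pos i 1 a"
  shows "c = pos (i + 1) 0 (pos i 1 a)"
proof (rule ccontr)
  assume neq: "\<not> ?thesis"
  have b: "pos i 1 a < 3" "R i a (pos i 1 a) = 1" by (rule pos[OF assms(1)]; simp)+
  have t: "pos (i + 1) 0 (pos i 1 a) < 3" "R (i + 1) (pos i 1 a) (pos (i + 1) 0 (pos i 1 a)) = 0"
    by (rule pos[OF b(1)]; simp)+
  show False
    using unique_hit[OF assms(1) b assms(2,3) t(1)] neq t(2) unfolding cnt_0_iff by auto
qed

text \<open>By \<open>edge\<close> an entry 2 of \<open>R (i + 1)\<close> leaves 0 for the
  \<open>L\<close> count, so with this color to its right vertex \<open>i\<close> never guesses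
  \<open>pos i 2 a\<close>.\<close>

lemma wrong_2:
  assumes "a < 3"
  shows "F i a (pos (i + 1) 2 (pos i 2 a)) \<noteq> pos i 2 a"
proof -
  have b: "pos i 2 a < 3" by (rule pos[OF assms]) simp
  have c: "pos (i + 1) 2 (pos i 2 a) < 3" "R (i + 1) (pos i 2 a) (pos (i + 1) 2 (pos i 2 a)) = 2"
    by (rule pos[OF b]; simp)+
  have "L i (pos i 2 a) (pos (i + 1) 2 (pos i 2 a)) = 0"
    using edge[OF b c(1), of i] c(2) by simp
  then have "\<forall>d<3. F i d (pos (i + 1) 2 (pos i 2 a)) \<noteq> pos i 2 a" unfolding cnt_0_iff .
  then show ?thesis using assms by simp
qed

text \<open>Let \<open>c\<close> be the right-hand side. The guess \<open>F i a c\<close> is one of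
  the three colors \<open>pos i k a\<close>; the values 0 and 2 of \<open>k\<close> are ruled out,
  and for 1 \<open>wrong_1\<close> identifies \<open>c\<close>.\<close>

lemma pos_relation:
  assumes "a < 3"
  shows "pos (i + 1) 0 (pos i 1 a) = pos (i + 1) 2 (pos i 2 a)"
proof -
  define c where "c = pos (i + 1) 2 (pos i 2 a)"
  have c: "c < 3" using assms by (simp add: c_def pos(1))
  define b where "b = F i a c"
  have b: "b < 3" using val assms c by (simp add: b_def)
  have k: "R i a b < 3" using R_le_2[OF assms b, of i] by simp
  have posb: "pos i (R i a b) a = b" by (rule pos_eqI[OF assms k b]) simp
  have "R i a b \<noteq> 0"
  proof
    assume "R i a b = 0"
    then show False using posb wrong_0[OF assms c, of i] by (simp add: b_def)
  qed
  moreover have "R i a b \<noteq> 2"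
  proof
    assume "R i a b = 2"
    then show False using posb wrong_2[OF assms, of i] by (simp add: b_def c_def)
  qed
  ultimately have "R i a b = 1" using k by linarith
  then have "b = pos i 1 a" using posb by simp
  then show ?thesis using wrong_1[OF assms c, of i] by (simp add: b_def c_def)
qed

section \<open>Following one family of bijections around the cycle\<close>

lemma pos_step_wrong:
  assumes "a < 3" "s < 3"
  shows "F i a (pos (i + 1) s (pos i s a)) \<noteq> pos i s a"
proof -
  have "F i a (pos (i + 1) 1 (pos i 1 a)) \<noteq> pos i 1 a"
  proof
    assume "F i a (pos (i + 1) 1 (pos i 1 a)) = pos i 1 a"
    then have "pos (i + 1) 1 (pos i 1 a) = pos (i + 1) 0 (pos i 1 a)"
      using wrong_1[OF assms(1)] assms(1) by (simp add: pos(1))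
    then show False using assms(1) by (simp add: pos_inj_k pos(1))
  qed
  moreover have "F i a (pos (i + 1) 0 (pos i 0 a)) \<noteq> pos i 0 a"
    using assms(1) by (intro wrong_0) (simp_all add: pos(1))
  ultimately show ?thesis
    using assms(2) wrong_2[OF assms(1), of i] unfolding less_3_cases[of s] by blast
qed

text \<open>Relative to \<open>pos i 0\<close> the other two families are fixed-point free and
  differ everywhere, so they are the two 3-cycles on three colors; \<open>eq\<close> decides which
  is which.\<close>

lemma pos_derangement:
  assumes v: "v0 < 3" "v1 < 3" "v2 < 3" "v0 \<noteq> v1" "v0 \<noteq> v2" "v1 \<noteq> v2"
    and eq: "pos i 0 v1 = pos i 2 v2"
  shows "pos i 1 v0 = pos i 0 v1" "pos i 1 v1 = pos i 0 v2" "pos i 1 v2 = pos i 0 v0"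
    "pos i 2 v0 = pos i 0 v2" "pos i 2 v1 = pos i 0 v0"
proof -
  have lt: "pos i k v0 < 3" "pos i k v1 < 3" "pos i k v2 < 3" if "k < 3" for k
    using v that by (simp_all add: pos(1))
  have neq: "pos i k v0 \<noteq> pos i k v1" "pos i k v0 \<noteq> pos i k v2" "pos i k v1 \<noteq> pos i k v2" if "k < 3" for k
    using v that by (simp_all add: pos_inj)
  have neqk: "pos i k v0 \<noteq> pos i k' v0" "pos i k v1 \<noteq> pos i k' v1" "pos i k v2 \<noteq> pos i k' v2"
    if "k < 3" "k' < 3" "k \<noteq> k'" for k k'
    using v that by (simp_all add: pos_inj_k)
  have cases: "x = pos i 0 v0 \<or> x = pos i 0 v1 \<or> x = pos i 0 v2" if "x < 3" for x
    by (rule three_distinct[OF that]) (use lt[of 0] neq[of 0] in auto)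
  show d0: "pos i 2 v0 = pos i 0 v2"
    using cases[OF lt(1)[of 2]] neqk(1)[of 2 0] neq(2)[of 2] eq by auto
  show d1: "pos i 2 v1 = pos i 0 v0"
    using cases[OF lt(2)[of 2]] neqk(2)[of 2 0] neq(1)[of 2] d0 by auto
  show "pos i 1 v0 = pos i 0 v1"
    using cases[OF lt(1)[of 1]] neqk(1)[of 1 0] neqk(1)[of 1 2] d0 by auto
  show "pos i 1 v1 = pos i 0 v2"
    using cases[OF lt(2)[of 1]] neqk(2)[of 1 0] neqk(2)[of 1 2] d1 by auto
  show "pos i 1 v2 = pos i 0 v0"
    using cases[OF lt(3)[of 1]] neqk(3)[of 1 0] neqk(3)[of 1 2] eq by auto
qed

text \<open>
  Coordinates in $\mathbb{Z}/3$ on the colors of vertex \<open>j\<close>, transported by \<open>pos 0\<close>; in them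
  \<open>pos s\<close> is translation by \<open>s\<close>.
\<close>

primrec frame :: "nat \<Rightarrow> nat \<Rightarrow> nat" where
  "frame 0 k = pos 0 (k mod 3) 0"
| "frame (Suc j) k = pos (int j + 1) 0 (frame j k)"

lemma frame_mod: "frame j (k mod 3) = frame j k"
  by (induction j) simp_all

lemma frame_less: "frame j k < 3"
  by (induction j) (simp_all add: pos(1))

lemma frame_distinct: "frame j 0 \<noteq> frame j 1" "frame j 0 \<noteq> frame j 2" "frame j 1 \<noteq> frame j 2"
  by (induction j) (simp_all add: pos_inj pos_inj_k frame_less)

lemma frame_steps_from:
  assumes "pos (int j + 1) 0 (frame j 1) = pos (int j + 1) 2 (frame j 2)" and "s < 3"
  shows "pos (int j + 1) s (frame j k) = frame (Suc j) (k + s)"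
proof -
  note d = pos_derangement[OF frame_less frame_less frame_less frame_distinct assms(1)]
  have "k mod 3 = 0 \<or> k mod 3 = 1 \<or> k mod 3 = 2" by presburger
  moreover have "pos (int j + 1) s (frame j k) = pos (int j + 1) s (frame j (k mod 3))"
    by (simp add: frame_mod)
  moreover have "frame (Suc j) (k + s) = frame (Suc j) ((k mod 3 + s) mod 3)"
    by (simp only: frame_mod mod_add_left_eq)
  ultimately show ?thesis
    using assms d unfolding less_3_cases by (elim disjE) (simp_all add: numeral_2_eq_2[symmetric] numeral_3_eq_3[symmetric])
qed

text \<open>\<open>pos_relation\<close> at the color \<open>frame j 0\<close> is exactly what
  orients the 3-cycles one position later, since \<open>frame (Suc j) 1\<close> and
  \<open>frame (Suc j) 2\<close> are its images under the families 1 and 2. For the start,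
  \<open>frame 0\<close> lists the images of color 0 of vertex -1.\<close>

lemma frame_step:
  assumes "s < 3"
  shows "pos (int j + 1) s (frame j k) = frame (Suc j) (k + s)"
proof -
  have "pos (int j + 1) 0 (frame j 1) = pos (int j + 1) 2 (frame j 2)"
  proof (induction j)
    case 0
    then show ?case using pos_relation[of 0 0] by simp
  next
    case (Suc j)
    have "pos (int j + 1) 1 (frame j 0) = frame (Suc j) (0 + 1)"
      "pos (int j + 1) 2 (frame j 0) = frame (Suc j) (0 + 2)"
      by (rule frame_steps_from[OF Suc]; simp)+
    then have "frame (Suc j) 1 = pos (int j + 1) 1 (frame j 0)"
      "frame (Suc j) 2 = pos (int j + 1) 2 (frame j 0)"
      by (simp_all only: add_0)
    then show ?case
      using pos_relation[OF frame_less, of "int j + 1" j 0] by (simp add: add.commute)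
  qed
  then show ?thesis using assms by (rule frame_steps_from)
qed

text \<open>\<open>frame 0\<close> and \<open>frame n\<close> are coordinates on the colors of the
  same vertex, compared through \<open>frame 0 m = frame n 0\<close>. Following family
  \<open>s\<close> from \<open>frame 0 m\<close> ends at \<open>frame n (m + n * s)\<close>, so it
  closes up when \<open>m + n * s\<close> is 0 modulo 3; this is solvable because \<open>n\<close>
  is invertible modulo 3.\<close>

lemma closed_wrong_coloring:
  assumes n: "n > 0" and per: "\<And>i. F (i + int n) = F i" and ndvd: "\<not> 3 dvd n"
  shows "\<exists>x. cyc_coloring n (\<lambda>_. 3) x \<and> (\<forall>i. F i (x (i - 1)) (x (i + 1)) \<noteq> x i)"
proof -
  define m where "m = R 0 0 (frame n 0)"
  have m: "m < 3" using R_le_2[OF _ frame_less, of 0 0 n 0] by (simp add: m_def)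
  have m0: "frame 0 m = frame n 0"
    using pos_eqI[OF _ m frame_less, of 0 0 n 0] m by (simp add: m_def)
  have "\<exists>s<3. (m + n * s) mod 3 = 0"
  proof -
    have *: "(m + n * s) mod 3 = (m + (n mod 3) * s) mod 3" for s
      by (metis mod_add_right_eq mod_mult_left_eq)
    have "n mod 3 = 1 \<or> n mod 3 = 2" using ndvd by presburger
    then show ?thesis
      using m unfolding ex_less_3 * unfolding less_3_cases by (elim disjE) simp_all
  qed
  then obtain s where s: "s < 3" "(m + n * s) mod 3 = 0" by (elim exE conjE)
  define c where "c j = frame j (m + j * s)" for j
  have c_step: "c (Suc j) = pos (int j + 1) s (c j)" for j
    using frame_step[OF s(1), of j "m + j * s"] by (simp add: c_def ac_simps)
  have "frame n (m + n * s) = frame n 0" using frame_mod[of n "m + n * s"] unfolding s(2) by simp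
  then have c_n: "c n = c 0" using m0 by (simp add: c_def)
  define x where "x i = c (nat (i mod int n))" for i
  have x3: "x i < 3" for i by (simp add: x_def c_def frame_less)
  have step: "x (i + 1) = pos (i + 1) s (x i)" for i
  proof -
    define j where "j = nat (i mod int n)"
    have j: "int j = i mod int n" using n by (simp add: j_def)
    have "F (int j + 1) = F (i + 1)"
      by (rule periodic_mod_eq[of F "int n"]) (simp_all add: per j mod_add_left_eq)
    then have "pos (int j + 1) k a = pos (i + 1) k a" for k a by (simp add: pos_def)
    moreover have "x (i + 1) = c (Suc j)"
    proof (cases "Suc j = n")
      case True
      have "(i + 1) mod int n = (int j + 1) mod int n" by (simp add: j mod_add_left_eq)
      also have "\<dots> = 0" using True[symmetric] by (simp add: add.commute)
      finally show ?thesis using True c_n by (simp add: x_def)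
    next
      case False
      have "int j < int n" unfolding j using n by (intro pos_mod_bound) simp
      then have "j < n" by simp
      have "(i + 1) mod int n = (int j + 1) mod int n" by (simp add: j mod_add_left_eq)
      also have "\<dots> = int (Suc j)" using False \<open>j < n\<close> by simp
      finally show ?thesis unfolding x_def by (simp only: nat_int)
    qed
    ultimately show ?thesis using c_step[of j] by (simp add: x_def j_def)
  qed
  have "F i (x (i - 1)) (x (i + 1)) \<noteq> x i" for i
    using pos_step_wrong[OF x3 s(1), of i "i - 1"] step[of i] step[of "i - 1"] by simp
  moreover have "cyc_coloring n (\<lambda>_. 3) x"
    unfolding cyc_coloring_def using x3 by (simp add: x_def)
  ultimately show ?thesis by blast
qed

end

lemma cyc_losing_all_3:
  assumes n: "n \<ge> 5" and ndvd: "\<not> 3 dvd n"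
  shows "\<not> cyc_winning n (\<lambda>_. 3)"
proof
  assume "cyc_winning n (\<lambda>_. 3)"
  then obtain f where f: "cyc_strategy n (\<lambda>_. 3) f" by (auto simp: cyc_winning_def)
  \<comment> \<open>In \<open>rigid\<close> guesses are colors; reduction modulo 3 achieves this and
    keeps every right guess.\<close>
  define F where "F i a c = f i a c mod 3" for i a c
  have per: "F (i + int n) = F i" for i
    using f by (simp add: cyc_strategy_def F_def fun_eq_iff)
  have F: "cyc_strategy n (\<lambda>_. 3) F"
    unfolding cyc_strategy_def
  proof (intro conjI allI impI)
    fix x assume x: "cyc_coloring n (\<lambda>_. 3) x"
    then obtain i where "f i (x (i - 1)) (x (i + 1)) = x i" using f unfolding cyc_strategy_def by blast
    moreover have "x i mod 3 = x i" using x by (simp add: cyc_coloring_def)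
    ultimately show "\<exists>i. F i (x (i - 1)) (x (i + 1)) = x i" unfolding F_def by metis
  qed (rule per)
  have val: "F i a c < 3" for i a c by (simp add: F_def)
  \<comment> \<open>Vertex \<open>i\<close> plays vertex 0 here; with \<open>i - 1\<close> in place
    of \<open>i\<close> it plays vertex 1.\<close>
  have game: "cyc_game_3 n (\<lambda>_. 3) (\<lambda>j. F (j + i))" for i
    using cyc_strategy_shift[OF F, of i] n by unfold_locales auto
  interpret rigid F
  proof
    fix a b :: nat and i assume ab: "a < 3" "b < 3"
    show "cnt (\<lambda>d. F i d b) a + cnt (F (i + 1) a) b = 2"
      using cyc_game_3.edge_count(1)[OF game[of i] _ ab] val by (simp add: add.commute)
  next
    fix a b i x y
    assume *: "a < 3" "b < 3" "cnt (F i a) b = 1" "x < 3" "F i a x = b" "y < 3" "y \<noteq> x"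
    then show "\<exists>d<3. F (i + 1) b d = y"
      using cyc_game_3.unique_row_value(1)[OF game[of "i - 1"], of a b x y] val by (simp add: add.commute)
  next
    fix a b i x y y' d
    assume *: "a < 3" "b < 3" "cnt (F i a) b = 1" "x < 3" "F i a x = b" "y < 3" "y \<noteq> x"
      "y' < 3" "y' \<noteq> x" "y' \<noteq> y" "d < 3" "F (i + 1) b d = x"
    then show "\<exists>e<3. F (i + 2) y e = d \<and> F (i + 2) y' e = d"
      using cyc_game_3.unique_row_value(2)[OF game[of "i - 1"], of a b x y y' d] val
      by (simp add: add.commute)
  qed (rule val)
  obtain x where "cyc_coloring n (\<lambda>_. 3) x" "\<And>i. F i (x (i - 1)) (x (i + 1)) \<noteq> x i"
    using closed_wrong_coloring[OF _ per ndvd] n by auto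
  then show False using F unfolding cyc_strategy_def by blast
qed

section \<open>The classification\<close>

lemma cyc_gameI:
  assumes "n \<ge> 4" "\<And>i. h (i + int n) = h i" "cyc_winning n h"
  obtains f where "cyc_game n h f"
  using assms unfolding cyc_winning_def cyc_game_def by blast

lemma cyc_winning_reflect_at: "cyc_winning n h \<Longrightarrow> cyc_winning n (\<lambda>j. h (i - j))"
  using cyc_winning_reflect[OF cyc_winning_shift[of n h i]] by simp

lemma cyc_losing_ge_3:
  assumes n: "n \<ge> 4" and h3: "\<And>j. h j \<ge> 3" and h4: "h i \<ge> 4"
    and per: "\<And>j. h (j + int n) = h j"
  shows "\<not> cyc_winning n h"
proof
  assume win: "cyc_winning n h"
  define g where "g j = (if j mod int n = 0 then 4 else 3 :: nat)" for j
  have "g j \<le> h (j + i)" for j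
  proof (cases "j mod int n = 0")
    case True
    then have "(j + i) mod int n = i mod int n" by (metis add_0 mod_add_left_eq)
    then have "h (j + i) = h i" by (rule periodic_mod_eq[of h "int n", OF per])
    then show ?thesis using h4 True by (simp add: g_def)
  qed (use h3 in \<open>simp add: g_def\<close>)
  then have "cyc_winning n g" by (rule cyc_winning_mono[OF cyc_winning_shift[OF win]])
  then obtain f where "cyc_game n g f"
    by (rule cyc_gameI[rotated 2]) (use n in \<open>simp_all add: g_def\<close>)
  then interpret cyc_game n g f .
  have h_vals: "g j = 3" if "0 < j" "j < int n" for j using that by (simp add: g_def)
  have "g 0 \<le> 3"
    by (rule all_3_but_one) (use h_vals[of 1] h_vals[of 2] h_vals[of "int n - 1"] h_last n h_vals in auto)
  then show False by (simp add: g_def)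
qed

lemma cyc_losing_4_2_4:
  assumes n: "n \<ge> 4" and win: "cyc_winning n h" and per: "\<And>j. h (j + int n) = h j"
    and h: "h 0 \<ge> 2" "h 1 \<ge> 4" "h (- 1) \<ge> 4"
    and h3: "\<And>j. 0 < j \<Longrightarrow> j < int n \<Longrightarrow> h j \<ge> 3"
  shows False
proof -
  define g where "g j = (if j mod int n = 0 then 2 else if j mod int n \<in> {1, int n - 1} then 4 else 3 :: nat)"
    for j
  have "g j \<le> h j" for j
  proof -
    have *: "h j = h (j mod int n)" by (rule periodic_mod_eq[of h "int n", OF per]) simp
    have "h (int n - 1) \<ge> 4" using h per[of "- 1"] by simp
    moreover have "0 \<le> j mod int n" "j mod int n < int n" using n by simp_all
    ultimately show ?thesis using h h3[of "j mod int n"] by (auto simp: g_def *)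
  qed
  then have "cyc_winning n g" by (rule cyc_winning_mono[OF win])
  then obtain f where "cyc_game n g f"
    by (rule cyc_gameI[rotated 2]) (use n in \<open>simp_all add: g_def\<close>)
  then interpret cyc_game n g f .
  have small: "g j = (if j = 0 then 2 else if j = 1 \<or> j = int n - 1 then 4 else 3)" if "0 \<le> j" "j < int n" for j
    using that by (simp add: g_def)
  show False
    by (rule no_4_2_4) (use small[of 0] small[of 1] small[of 2] small[of "int n - 1"] h_last n small in auto)
qed

lemma cyc_losing_4_2_3_4:
  assumes n: "n \<ge> 4" and win: "cyc_winning n h" and per: "\<And>j. h (j + int n) = h j"
    and h: "h 0 \<ge> 2" "h 2 \<ge> 4" "h (- 1) \<ge> 4"
    and h3: "\<And>j. 0 < j \<Longrightarrow> j < int n \<Longrightarrow> h j \<ge> 3"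
  shows False
proof -
  define g where "g j = (if j mod int n = 0 then 2 else if j mod int n \<in> {2, int n - 1} then 4 else 3 :: nat)"
    for j
  have "g j \<le> h j" for j
  proof -
    have *: "h j = h (j mod int n)" by (rule periodic_mod_eq[of h "int n", OF per]) simp
    have "h (int n - 1) \<ge> 4" using h per[of "- 1"] by simp
    moreover have "0 \<le> j mod int n" "j mod int n < int n" using n by simp_all
    ultimately show ?thesis using h h3[of "j mod int n"] by (auto simp: g_def *)
  qed
  then have "cyc_winning n g" by (rule cyc_winning_mono[OF win])
  then obtain f where "cyc_game n g f"
    by (rule cyc_gameI[rotated 2]) (use n in \<open>simp_all add: g_def\<close>)
  then interpret cyc_game n g f .
  have small: "g j = (if j = 0 then 2 else if j = 2 \<or> j = int n - 1 then 4 else 3)" if "0 \<le> j" "j < int n" for j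
    using that by (simp add: g_def)
  show False
    by (rule no_4_2_3_4) (use small[of 0] small[of 1] small[of 2] small[of "int n - 1"] h_last n small in auto)
qed

text \<open>Lowering to the values 2, 3, 5 keeps the separation. A 2 cannot then be next to a 2 or,
  on either side, to a 3, so every 2 would lie between two 5s, and this loses as well.\<close>

lemma cyc_losing_separated:
  assumes n: "n \<ge> 4" and per: "\<And>j. h (j + int n) = h j" and ge2: "\<And>j. h j \<ge> 2" and two: "h i0 = 2"
    and sep: "\<And>i j. i < j \<Longrightarrow> j \<le> i + int n \<Longrightarrow> h i = 2 \<Longrightarrow> h j = 2 \<Longrightarrow> \<exists>m. i < m \<and> m < j \<and> 5 \<le> h m"
  shows "\<not> cyc_winning n h"
proof
  assume win: "cyc_winning n h"
  define g where "g j = (if 5 \<le> h j then 5 else if h j = 2 then 2 else 3 :: nat)" for j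
  have "g j \<le> h j" for j using ge2[of j] by (auto simp: g_def)
  then have win_g: "cyc_winning n g" by (rule cyc_winning_mono[OF win])
  have per_g: "g (j + int n) = g j" for j by (simp add: g_def per)
  have per_g': "g (j - int n) = g j" for j using per_g[of "j - int n"] by simp
  have vals: "g j \<in> {2, 3, 5}" for j by (simp add: g_def)
  have sep_g: "\<exists>m. i < m \<and> m < j \<and> g m = 5" if "i < j" "j \<le> i + int n" "g i = 2" "g j = 2" for i j
  proof -
    have "h i = 2" "h j = 2" using that(3,4) by (simp_all add: g_def split: if_splits)
    then have "\<exists>m. i < m \<and> m < j \<and> 5 \<le> h m" by (rule sep[OF that(1,2)])
    then obtain m where "i < m" "m < j" "5 \<le> h m" by blast
    then show ?thesis by (intro exI[of _ m]) (simp add: g_def)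
  qed
  have no_2_3: False if "g i = 2" "g (i + 1) = 3" for i
  proof -
    have "cyc_winning n (\<lambda>j. g (j + i))" by (rule cyc_winning_shift[OF win_g])
    then obtain f where "cyc_game n (\<lambda>j. g (j + i)) f"
      by (rule cyc_gameI[rotated 2]) (use n per_g[of "_ + i"] in \<open>simp_all add: algebra_simps\<close>)
    then interpret cyc_game n "\<lambda>j. g (j + i)" f .
    have "separated"
      unfolding separated_def
    proof (intro allI impI)
      fix k l assume "k < l" "l \<le> k + int n" "g (k + i) = 2" "g (l + i) = 2"
      then obtain m where "k + i < m" "m < l + i" "g m = 5" using sep_g[of "k + i" "l + i"] by auto
      then show "\<exists>m>k. m < l \<and> g (m + i) = 5" by (intro exI[of _ "m - i"]) auto
    qed
    then show False using separated_2_3 vals that by (simp add: add.commute)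
  qed
  have no_3_2: False if "g i = 2" "g (i - 1) = 3" for i
  proof -
    have "cyc_winning n (\<lambda>j. g (i - j))" by (rule cyc_winning_reflect_at[OF win_g])
    then obtain f where "cyc_game n (\<lambda>j. g (i - j)) f"
      by (rule cyc_gameI[rotated 2]) (use n per_g'[of "i - _"] in \<open>simp_all add: algebra_simps\<close>)
    then interpret cyc_game n "\<lambda>j. g (i - j)" f .
    have "separated"
      unfolding separated_def
    proof (intro allI impI)
      fix k l assume "k < l" "l \<le> k + int n" "g (i - k) = 2" "g (i - l) = 2"
      then obtain m where "i - l < m" "m < i - k" "g m = 5" using sep_g[of "i - l" "i - k"] by auto
      then show "\<exists>m>k. m < l \<and> g (i - m) = 5" by (intro exI[of _ "i - m"]) auto
    qed
    then show False using separated_2_3 vals that by simp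
  qed
  have nbr: "g (k - 1) = 5 \<and> g (k + 1) = 5" if "g k = 2" for k
  proof -
    have "g (k + 1) \<noteq> 2"
      using sep_g[of k "k + 1"] that n by auto
    moreover have "g (k - 1) \<noteq> 2"
      using sep_g[of "k - 1" k] that n by auto
    moreover have "g (k + 1) \<noteq> 3" "g (k - 1) \<noteq> 3" using no_2_3[OF that] no_3_2[OF that] by auto
    ultimately show ?thesis using vals[of "k + 1"] vals[of "k - 1"] by auto
  qed
  have i0: "g i0 = 2" using two by (simp add: g_def)
  have "cyc_winning n (\<lambda>j. g (j + i0))" by (rule cyc_winning_shift[OF win_g])
  then obtain f where "cyc_game n (\<lambda>j. g (j + i0)) f"
    by (rule cyc_gameI[rotated 2]) (use n per_g[of "_ + i0"] in \<open>simp_all add: algebra_simps\<close>)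
  then interpret cyc_game n "\<lambda>j. g (j + i0)" f .
  show False
  proof (rule separated_5_2_5)
    show "g (k - 1 + i0) = 5" if "g (k + i0) = 2" for k
      using nbr[OF that] by (simp add: algebra_simps)
  qed (use vals i0 nbr[OF i0] in \<open>auto simp: add.commute\<close>)
qed

lemma cyc_winning_cases:
  assumes n: "n \<ge> 4" and per: "\<And>j. h (j + int n) = h j" and ge2: "\<And>j. h j \<ge> 2"
    and win: "cyc_winning n h"
    and no_path: "\<And>i m. 0 < m \<Longrightarrow> m < int n \<Longrightarrow> h i = 2 \<Longrightarrow> h (i + m) = 2 \<Longrightarrow>
      \<exists>k. 0 < k \<and> k < m \<and> 5 \<le> h (i + k)"
    and no_233: "\<And>i. \<forall>j. h j \<le> 4 \<Longrightarrow> \<not> (h i = 2 \<and> h (i + 1) = 3 \<and> h (i + 2) = 3)"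
    and no_332: "\<And>i. \<forall>j. h j \<le> 4 \<Longrightarrow> \<not> (h i = 2 \<and> h (i - 1) = 3 \<and> h (i - 2) = 3)"
    and no_323: "\<And>i. \<forall>j. h j \<le> 4 \<Longrightarrow> \<not> (h i = 2 \<and> h (i - 1) = 3 \<and> h (i + 1) = 3)"
  shows "(n = 4 \<or> 3 dvd n) \<and> (\<forall>j. h j \<le> 3)"
proof -
  have h_mod: "h i = h j" if "i mod int n = j mod int n" for i j
    by (rule periodic_mod_eq[of h "int n", OF per that])
  have le4: "\<forall>j. h j \<le> 4"
  proof (rule ccontr)
    assume "\<not> ?thesis"
    then obtain j where "4 < h j" by (auto simp: not_le)
    then have j: "5 \<le> h j" by simp
    show False
    proof (cases "\<exists>i. h i = 2")
      case True
      then obtain i0 where "h i0 = 2" by blast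
      then have "\<not> cyc_winning n h"
      proof (rule cyc_losing_separated[of n h, OF n per ge2])
        fix i k assume ik: "i < k" "k \<le> i + int n" "h i = 2" "h k = 2"
        show "\<exists>m. i < m \<and> m < k \<and> 5 \<le> h m"
        proof (cases "k = i + int n")
          case False
          then obtain l where "0 < l" "l < k - i" "5 \<le> h (i + l)"
            using no_path[of "k - i" i] ik by auto
          then show ?thesis by (intro exI[of _ "i + l"]) auto
        next
          \<comment> \<open>A 2 and its own copy after a full turn: \<open>no_path\<close> does not
            apply, but the hatness \<open>h j \<ge> 5\<close> is met on the way.\<close>
          case True
          define l where "l = (j - i) mod int n"
          have "h (i + l) = h j" by (rule h_mod) (simp add: l_def mod_add_right_eq)
          moreover have "0 \<le> l" "l < int n" using n by (simp_all add: l_def)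
          moreover have "l \<noteq> 0" using calculation(1) j ik(3) by auto
          ultimately show ?thesis using j True by (intro exI[of _ "i + l"]) auto
        qed
      qed
      then show ?thesis using win by blast
    next
      case False
      then have "h i \<ge> 3" for i using ge2[of i] by (metis Suc_leI eval_nat_numeral(3) le_neq_implies_less)
      then show ?thesis using cyc_losing_ge_3[of n h j, OF n _ _ per] j win by simp
    qed
  qed
  have no_2: "h i \<noteq> 2" for i
  proof
    assume i: "h i = 2"
    have far: "h (i + m) \<ge> 3" if "0 < m" "m < int n" for m
    proof -
      have "h (i + m) \<noteq> 2"
      proof
        assume "h (i + m) = 2"
        then have "\<exists>k. 0 < k \<and> k < m \<and> 5 \<le> h (i + k)" by (rule no_path[OF that i])
        then obtain k where "5 \<le> h (i + k)" by blast
        then show False using le4[rule_format, of "i + k"] by simp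
      qed
      then show ?thesis using ge2[of "i + m"] by simp
    qed
    have far': "h (i - m) \<ge> 3" if "0 < m" "m < int n" for m
    proof -
      have "h (i - m) = h (i + (int n - m))" using per[of "i - m"] by (simp add: algebra_simps)
      then show ?thesis using far[of "int n - m"] that by simp
    qed
    \<comment> \<open>The 2 at \<open>i\<close> is now the only one. If a neighbor has hatness 3,
      the excluded triples force at least 4 at the other neighbor and beyond the 3; otherwise both
      neighbors have at least 4.\<close>
    consider "h (i + 1) = 3" | "h (i - 1) = 3" | "h (i + 1) \<noteq> 3" "h (i - 1) \<noteq> 3" by blast
    then show False
    proof cases
      case 1
      show False
      proof (rule cyc_losing_4_2_3_4[OF n cyc_winning_shift[OF win, of i]])
        show "h (j + int n + i) = h (j + i)" for j using per[of "j + i"] by (simp add: algebra_simps)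
        show "4 \<le> h (2 + i)" using far[of 2] no_233[OF le4, of i] i 1 n by (simp add: add.commute)
        show "4 \<le> h (- 1 + i)" using far'[of 1] no_323[OF le4, of i] i 1 n by simp
        show "3 \<le> h (j + i)" if "0 < j" "j < int n" for j using far[OF that] by (simp add: add.commute)
      qed (use i in simp)
    next
      case 2
      show False
      proof (rule cyc_losing_4_2_3_4[OF n cyc_winning_reflect_at[OF win, of i]])
        show "h (i - (j + int n)) = h (i - j)" for j using per[of "i - (j + int n)"] by simp
        show "4 \<le> h (i - 2)" using far'[of 2] no_332[OF le4, of i] i 2 n by simp
        show "4 \<le> h (i - - 1)" using far[of 1] no_323[OF le4, of i] i 2 n by simp
        show "3 \<le> h (i - j)" if "0 < j" "j < int n" for j using far'[OF that] by simp
      qed (use i in simp)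
    next
      case 3
      show False
      proof (rule cyc_losing_4_2_4[OF n cyc_winning_shift[OF win, of i]])
        show "h (j + int n + i) = h (j + i)" for j using per[of "j + i"] by (simp add: algebra_simps)
        show "4 \<le> h (1 + i)" using far[of 1] 3 n by (simp add: add.commute)
        show "4 \<le> h (- 1 + i)" using far'[of 1] 3 n by simp
        show "3 \<le> h (j + i)" if "0 < j" "j < int n" for j using far[OF that] by (simp add: add.commute)
      qed (use i in simp)
    qed
  qed
  have ge3: "h i \<ge> 3" for i using no_2[of i] ge2[of i] by linarith
  have h3: "h i = 3" for i
  proof (rule ccontr)
    assume "h i \<noteq> 3"
    then have "h i \<ge> 4" using ge3[of i] by linarith
    then show False using cyc_losing_ge_3[of n h i, OF n ge3 _ per] win by blast
  qed
  then have "cyc_winning n (\<lambda>_. 3)" by (intro cyc_winning_mono[OF win]) simp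
  then have "n = 4 \<or> 3 dvd n" using cyc_losing_all_3[of n] n by (cases "n = 4") auto
  then show ?thesis using h3 by simp
qed

section \<open>From sequences back to the cycle graph\<close>

lemma cyc_param_simple_graph:
  assumes "cyc_param C n p"
  shows "simple_graph C"
proof -
  have "finite (verts C)"
    using cyc_param_imp_cyclic_ordering[OF assms] bij_betw_finite
    unfolding cyclic_ordering_def by blast
  moreover have "e \<subseteq> verts C \<and> card e = 2" if "e \<in> edges C" for e
  proof -
    obtain i where e: "e = {p i, p (i + 1)}" using assms \<open>e \<in> edges C\<close> by (auto simp: cyc_param_def)
    have "p i \<noteq> p (i + 1)"
    proof
      assume "p i = p (i + 1)"
      then have "(i + 1) mod int n = i mod int n" using assms by (simp add: cyc_param_def)
      then have "int n dvd 1" by (simp add: mod_eq_dvd_iff)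
      then show False using assms by (simp add: cyc_param_def)
    qed
    then show ?thesis using assms e by (auto simp: cyc_param_def)
  qed
  ultimately show ?thesis by (simp add: simple_graph_def)
qed

text \<open>All vertices stay and one edge goes, the one preceding the first 2; the rotation
  \<open>q\<close> places it between positions -1 and 0, across which nobody reads.\<close>

lemma path_2_4_2_subgame:
  assumes p: "cyc_param C n p" and pos: "\<And>v. v \<in> verts C \<Longrightarrow> h v \<ge> 1"
    and m: "0 < m" "m < int n" and ends: "h (p i) = 2" "h (p (i + m)) = 2"
    and between: "\<And>k. 0 < k \<Longrightarrow> k < m \<Longrightarrow> h (p (i + k)) \<le> 4"
  shows "\<exists>G' h'. proper_subgame G' h' C h \<and> winning G' h'"
proof -
  define q where "q j = p (j + i)" for j
  have q: "cyc_param C n q" unfolding q_def by (rule cyc_param_shift[OF p])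
  then have n: "n \<ge> 3" and range_q: "range q = verts C"
    and q_eq: "\<And>i j. q i = q j \<longleftrightarrow> i mod int n = j mod int n"
    and E: "edges C = range (\<lambda>j. {q j, q (j + 1)})"
    by (auto simp: cyc_param_def)
  define h' where "h' = restrict h (verts C)"
  have h': "h' (q j) = h (q j)" for j using range_q by (auto simp: h'_def)
  obtain f where f: "cyc_strategy n (\<lambda>j. h' (q j)) f"
    and right: "\<And>i a b b'. i mod int n = int n - 1 \<Longrightarrow> f i a b = f i a b'"
    and left: "\<And>i a a' b. i mod int n = 0 \<Longrightarrow> f i a b = f i a' b"
  proof (rule cyc_strategy_2_4_2[OF m, of "\<lambda>j. h' (q j)"])
    show "h' (q 0) \<le> 2" "h' (q m) \<le> 2" using ends unfolding h' by (simp_all add: q_def add.commute)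
    show "h' (q k) \<le> 4" if "0 < k" "k < m" for k
      using between[OF that] unfolding h' by (simp add: q_def add.commute)
  qed blast
  define G where "G = C\<lparr>edges := edges C - {{q (- 1), q 0}}\<rparr>"
  have "{q (- 1), q (- 1 + 1)} \<in> edges C" unfolding E by blast
  then have "G \<noteq> C" unfolding G_def by (metis DiffE add.left_inverse graph.select_convs(2) graph.surjective
        graph.update_convs(2) insertI1)
  moreover have "simple_graph C" by (rule cyc_param_simple_graph[OF p])
  then have "subgraph G C"
    by (auto simp: subgraph_def simple_graph_def G_def)
  ultimately have "proper_subgame G h' C h"
    by (simp add: proper_subgame_def subgame_def h'_def G_def)
  moreover have "winning G h'"
  proof (rule cyc_strategy_imp_winning[OF q f])
    show "verts G = verts C" by (simp add: G_def)
    show "h' v \<ge> 1" if "v \<in> verts C" for v using pos[OF that] that by (simp add: h'_def)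
    fix j assume "{q j, q (j + 1)} \<notin> edges G"
    then have "{q j, q (j + 1)} = {q (- 1), q 0}" by (auto simp: G_def E)
    then have "q j = q (- 1) \<and> q (j + 1) = q 0 \<or> q j = q 0 \<and> q (j + 1) = q (- 1)"
      by (auto simp: doubleton_eq_iff)
    \<comment> \<open>Traversing the deleted edge backwards would identify the two neighbors of
      \<open>q 0\<close>.\<close>
    moreover have "\<not> (q j = q 0 \<and> q (j + 1) = q (- 1))"
    proof
      assume *: "q j = q 0 \<and> q (j + 1) = q (- 1)"
      then have "q (j + 1) = q (0 + 1)" unfolding q_eq by (metis mod_add_left_eq)
      then show False using * cyc_param_dist2[OF q, of 0] by simp
    qed
    ultimately have "j mod int n = int n - 1" "(j + 1) mod int n = 0"
      using n by (auto simp: q_eq zmod_minus1)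
    then have "f j a b = f j a b'" "f (j + 1) a b = f (j + 1) a' b" for a a' b b'
      using left[of "j + 1" a b a'] right[of j a b b'] by auto
    then show "(\<forall>a b b'. f j a b = f j a b') \<and> (\<forall>a a' b. f (j + 1) a b = f (j + 1) a' b)"
      by blast
  qed
  ultimately show ?thesis by blast
qed

lemma triangle_sum_iff:
  assumes p: "cyc_param C 3 p" and pos: "\<And>v. v \<in> verts C \<Longrightarrow> h v \<ge> 1"
  shows "(\<Sum>v\<in>verts C. 1 / real (h v)) \<ge> 1 \<longleftrightarrow>
    h (p 0) * h (p 1) * h (p 2) \<le> h (p 1) * h (p 2) + h (p 0) * h (p 2) + h (p 0) * h (p 1)"
proof -
  define x y z where "x = real (h (p 0))" and "y = real (h (p 1))" and "z = real (h (p 2))"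
  have "bij_betw (\<lambda>k. p (int k)) {..<3} (verts C)"
    using cyc_param_imp_cyclic_ordering[OF p] by (simp add: cyclic_ordering_def)
  then have "(\<Sum>v\<in>verts C. 1 / real (h v)) = (\<Sum>k<3. 1 / real (h (p (int k))))"
    by (simp add: sum.reindex_bij_betw[symmetric])
  also have "\<dots> = 1 / x + 1 / y + 1 / z"
    by (simp add: eval_nat_numeral lessThan_Suc x_def y_def z_def)
  finally have sum: "(\<Sum>v\<in>verts C. 1 / real (h v)) = 1 / x + 1 / y + 1 / z" .
  have "p j \<in> verts C" for j using p by (auto simp: cyc_param_def)
  then have xyz: "x > 0" "y > 0" "z > 0"
    using pos[of "p 0"] pos[of "p 1"] pos[of "p 2"] by (simp_all add: x_def y_def z_def Suc_le_eq)
  have "1 / x + 1 / y + 1 / z = (y * z + x * z + x * y) / (x * y * z)"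
    using xyz by (simp add: field_simps)
  then have "1 / x + 1 / y + 1 / z \<ge> 1 \<longleftrightarrow> x * y * z \<le> y * z + x * z + x * y"
    using xyz by (simp add: le_divide_eq)
  also have "\<dots> \<longleftrightarrow> real (h (p 0) * h (p 1) * h (p 2))
      \<le> real (h (p 1) * h (p 2) + h (p 0) * h (p 2) + h (p 0) * h (p 1))"
    by (simp add: x_def y_def z_def)
  finally show ?thesis unfolding sum of_nat_le_iff .
qed

theorem theorem1p1:
  fixes C :: "'a graph" and n :: nat and h :: "'a \<Rightarrow> nat"
  assumes "n \<ge> 3"
    and "cycle_graph C n"
    and "\<forall>v\<in>verts C. h v \<ge> 2"
  shows "winning C h \<longleftrightarrow>
      ((n = 4 \<or> 3 dvd n) \<and> (\<forall>v\<in>verts C. h v \<le> 3))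
    \<or> (n = 3 \<and> (\<Sum>v\<in>verts C. 1 / real (h v)) \<ge> 1)
    \<or> (\<exists>G' h'. proper_subgame G' h' C h \<and> winning G' h')
    \<or> ((\<exists>x y z. consecutive_on_cycle C n x y z \<and>
            ((h x, h y, h z) = (2, 3, 3) \<or> (h x, h y, h z) = (3, 2, 3)))
        \<and> (\<forall>v\<in>verts C. h v \<le> 4))"
    (is "_ \<longleftrightarrow> ?one \<or> ?two \<or> ?three \<or> ?four")
proof -
  obtain c where "cyclic_ordering C n c" using assms(2) by (auto simp: cycle_graph_def)
  then obtain p where p: "cyc_param C n p" using cyclic_ordering_imp_cyc_param by blast
  have pV: "p i \<in> verts C" for i using p by (auto simp: cyc_param_def)
  have V: "\<exists>i. v = p i" if "v \<in> verts C" for v using p that by (auto simp: cyc_param_def)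
  have pos: "h v \<ge> 1" if "v \<in> verts C" for v using assms(3) that by fastforce
  have triangle: "winning C h \<longleftrightarrow> ?two" if n3: "n = 3"
  proof -
    have q: "cyc_param C 3 p" using p n3 by simp
    have pos': "h (p i) > 0" for i using pos[OF pV] by (simp add: Suc_le_eq)
    have "p (i + 3) = p i" for i using q by (simp add: cyc_param_def)
    then have "cyc_winning 3 (\<lambda>i. h (p i)) \<longleftrightarrow> ?two"
      using cyc_winning_triangle[of "\<lambda>i. h (p i)"] cyc_winning_triangle_imp[of "\<lambda>i. h (p i)"] pos'
        triangle_sum_iff[OF q pos] n3 by auto
    moreover have "winning C h \<longleftrightarrow> cyc_winning 3 (\<lambda>i. h (p i))"
      using winning_imp_cyc_winning[OF q, of h] cyc_winning_imp_winning[OF q, of h] pos by blast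
    ultimately show ?thesis by blast
  qed
  show ?thesis
  proof
    assume win: "winning C h"
    show "?one \<or> ?two \<or> ?three \<or> ?four"
    proof (cases "n = 3")
      case True
      then show ?thesis using triangle win by blast
    next
      case False
      then have n: "n \<ge> 4" using assms(1) by linarith
      show ?thesis
      proof (rule ccontr)
        assume neg: "\<not> ?thesis"
        have le4: "\<forall>v\<in>verts C. h v \<le> 4" if "\<forall>j. h (p j) \<le> 4" using V that by blast
        have seq: "(h (q j), h (q (j + 1)), h (q (j + 2))) \<noteq> (2, 3, 3)"
          "(h (q j), h (q (j + 1)), h (q (j + 2))) \<noteq> (3, 2, 3)"
          if "\<forall>j. h (p j) \<le> 4" "cyc_param C n q" for q j
          using neg le4[OF that(1)] consecutive_on_cycle_cyc_param[OF that(2), of j] by blast+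
        have "(n = 4 \<or> 3 dvd n) \<and> (\<forall>j. h (p j) \<le> 3)"
        proof (rule cyc_winning_cases[OF n])
          have "p (j + int n) = p j" for j using p by (simp add: cyc_param_def)
          then show "h (p (j + int n)) = h (p j)" for j by simp
          show "2 \<le> h (p j)" for j using assms(3) pV by blast
          show "cyc_winning n (\<lambda>j. h (p j))" by (rule winning_imp_cyc_winning[OF p win])
          show "\<exists>k. 0 < k \<and> k < m \<and> 5 \<le> h (p (i + k))"
            if "0 < m" "m < int n" "h (p i) = 2" "h (p (i + m)) = 2" for i m
          proof (rule ccontr)
            assume "\<not> ?thesis"
            then have between: "h (p (i + k)) \<le> 4" if "0 < k" "k < m" for k using that by force
            have ?three
              by (rule path_2_4_2_subgame[OF p _ that between]) (use pos in auto)
            then show False using neg by blast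
          qed
          fix i assume h4: "\<forall>j. h (p j) \<le> 4"
          show "\<not> (h (p i) = 2 \<and> h (p (i + 1)) = 3 \<and> h (p (i + 2)) = 3)"
            using seq(1)[OF h4 p, of i] by simp
          \<comment> \<open>Read backwards, this is a triple 2, 3, 3 of the reflected ordering,
            starting at \<open>- i\<close>.\<close>
          show "\<not> (h (p i) = 2 \<and> h (p (i - 1)) = 3 \<and> h (p (i - 2)) = 3)"
            using seq(1)[OF h4 cyc_param_reflect[OF p], of "- i"] by simp
          show "\<not> (h (p i) = 2 \<and> h (p (i - 1)) = 3 \<and> h (p (i + 1)) = 3)"
            using seq(2)[OF h4 p, of "i - 1"] by (simp add: add.commute)
        qed
        then have ?one using V by blast
        then show False using neg by blast
      qed
    qed
  next
    assume "?one \<or> ?two \<or> ?three \<or> ?four"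
    then consider ?one | ?two | ?three | ?four by blast
    then show "winning C h"
    proof cases
      case 1
      then have "h (p i) \<le> 3" for i using pV by blast
      then have "cyc_winning n (\<lambda>i. h (p i))"
        using 1 cyc_winning_4[of "\<lambda>i. h (p i)"] cyc_winning_3_dvd[OF assms(1), of "\<lambda>i. h (p i)"] by blast
      then show ?thesis by (rule cyc_winning_imp_winning[OF p]) (use pos in auto)
    next
      case 2
      then show ?thesis using triangle by blast
    next
      case 3
      then obtain G' h' where "subgraph G' C" "winning G' h'" "h' = restrict h (verts G')"
        by (auto simp: proper_subgame_def subgame_def)
      then show ?thesis by (rule winning_subgraph) (use pos in auto)
    next
      case 4
      then obtain x y z where cons: "consecutive_on_cycle C n x y z"
        and xyz: "(h x, h y, h z) = (2, 3, 3) \<or> (h x, h y, h z) = (3, 2, 3)" by blast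
      obtain q where q: "cyc_param C n q" and eq: "x = q 0" "y = q 1" "z = q 2"
        using consecutive_on_cycleE[OF cons] by blast
      have "q j \<in> verts C" for j using q by (auto simp: cyc_param_def)
      then have h4: "h (q j) \<le> 4" for j using 4 by blast
      have "cyc_winning n (\<lambda>i. h (q i))"
      proof (cases "n = 3")
        \<comment> \<open>In a triangle condition 4 gives 1/2 + 1/3 + 1/3 > 1.\<close>
        case True
        have "cyc_winning 3 (\<lambda>i. h (q i))"
          using xyz eq by (intro cyc_winning_triangle) auto
        then show ?thesis using True by simp
      next
        case False
        then have "n \<ge> 4" using assms(1) by linarith
        then show ?thesis
          using xyz eq h4 cyc_winning_2_3_3[of n "\<lambda>i. h (q i)"] cyc_winning_3_2_3[of n "\<lambda>i. h (q i)"] by auto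
      qed
      then show ?thesis by (rule cyc_winning_imp_winning[OF q]) (use pos in auto)
    qed
  qed
qed

end
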